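(* Let $X$ be a $\operatorname{cof}$-regular ballean. The following are equivalent: (1) for every $n\ge1$ and every subgroup $G\subset S_n$ the ballean $[X]^n_G$ is normal; (2) for some $n\ge3$ and some subgroup $G\subset S_n$ the ballean $[X]^n_G$ is normal; (3) for every $n\ge1$ the power $X^n$ is normal; (4) for some $n\ge2$ the power $X^n$ is normal; (5) the bornology $\mathcal B_X$ has a linearly ordered base. If moreover $X$ is not ultranormal, then (1)–(5) are also equivalent to each of: (6) for some $n\ge2$ and some subgroup $G\subset S_n$ the ballean $[X]^n_G$ is normal; (7) the symmetric square $[X]^2=[X]^2_{S_2}$ is normal; (8) the hypersymmetric square $[X]^{\le2}$ is normal; (9) for some $n\ge2$ the ballean $[X]^{\le n}$ is normal; (10) for every $n\ge1$ the ballean $[X]^{\le n}$ is normal; (11) the hyperballean $[X]^{\mathcal B}$ is normal.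
   Context: A ballean is a pair $(X,\mathcal E_X)$ where $X$ is a set and $\mathcal E_X$ is a family of subsets of $X\times X$ (entourages) such that: each $E\in\mathcal E_X$ contains the diagonal $\Delta_X$; for any $E,F\in\mathcal E_X$ there is $D\in\mathcal E_X$ with $E\circ F^{-1}\subset D$; and $\bigcup\mathcal E_X=X\times X$. For $E\in\mathcal E_X$, $x\in X$, $A\subset X$: $E[x]=\{y:(x,y)\in E\}$, $E[A]=\bigcup_{a\in A}E[a]$. $B\subset X$ is bounded if $B\subset E[x]$ for some $E\in\mathcal E_X$, $x\in X$; $\mathcal B_X$ is the family of bounded sets. Sets $A,B$ are asymptotically disjoint if $E[A]\cap E[B]\in\mathcal B_X$ for all $E\in\mathcal E_X$; $U$ is an asymptotic neighborhood of $A$ if $E[A]\setminus U\in\mathcal B_X$ for all $E$; $X$ is normal if any two asymptotically disjoint sets have disjoint asymptotic neighborhoods, and ultranormal if it contains no two unbounded asymptotically disjoint sets. For a poset $P$, $\operatorname{cof}(P)$ is the least cardinality of a cofinal subset (equal to $1$ if $P$ has a largest element); $X$ is $\operatorname{cof}$-regular if $\operatorname{cof}(\mathcal E_X)=\operatorname{cof}(\mathcal B_X)$ (ordered by inclusion). A linearly ordered base of $\mathcal B_X$ is a subfamily linearly ordered by inclusion such that every bounded set is contained in a member. The power $X^n$ ($n=\{0,\dots,n-1\}$) has entourages $\{(x,y)\in X^n\times X^n:(x(i),y(i))\in E_i\ \forall i\}$, $E_i\in\mathcal E_X$. For a subgroup $G\subset S_n$, $[X]^n_G=\{xG:x\in X^n\}$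 where $xG=\{x\circ g:g\in G\}$, with entourages $\hat E=\{(xG,yG):(x,y)\in E\}$ for $E$ an entourage of $X^n$. The hyperballean $[X]^{\mathcal B}$ is $\mathcal B_X\setminus\{\emptyset\}$ with entourages $\hat E=\{(A,B):A\subset E[B],\ B\subset E[A]\}$, $E\in\mathcal E_X$; $[X]^{\le n}$ is its subballean $\{A:|A|\le n\}$ with restricted entourages. *)

theory Defs
  imports "HOL-Library.Equipollence" "HOL-Library.FuncSet" "HOL-Combinatorics.Permutations"
begin

definition ballean :: "'b set \<Rightarrow> ('b \<times> 'b) set set \<Rightarrow> bool" where
  "ballean X Ent \<longleftrightarrow>
     (\<forall>e\<in>Ent. e \<subseteq> X \<times> X \<and> Id_on X \<subseteq> e) \<and>
     (\<forall>e\<in>Ent. \<forall>f\<in>Ent. \<exists>d\<in>Ent. e O converse f \<subseteq> d) \<and>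
     \<Union>Ent = X \<times> X"

definition bounded_in :: "'b set \<Rightarrow> ('b \<times> 'b) set set \<Rightarrow> 'b set \<Rightarrow> bool" where
  "bounded_in X Ent B \<longleftrightarrow> (\<exists>e\<in>Ent. \<exists>x\<in>X. B \<subseteq> e `` {x})"

definition bornology :: "'b set \<Rightarrow> ('b \<times> 'b) set set \<Rightarrow> 'b set set" where
  "bornology X Ent = {B. bounded_in X Ent B}"

definition asym_disjoint :: "'b set \<Rightarrow> ('b \<times> 'b) set set \<Rightarrow> 'b set \<Rightarrow> 'b set \<Rightarrow> bool" where
  "asym_disjoint X Ent A B \<longleftrightarrow> (\<forall>e\<in>Ent. bounded_in X Ent (e `` A \<inter> e `` B))"

definition asym_nbhd :: "'b set \<Rightarrow> ('b \<times> 'b) set set \<Rightarrow> 'b set \<Rightarrow> 'b set \<Rightarrow> bool" where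
  "asym_nbhd X Ent U A \<longleftrightarrow> (\<forall>e\<in>Ent. bounded_in X Ent (e `` A - U))"

definition normal_ballean :: "'b set \<Rightarrow> ('b \<times> 'b) set set \<Rightarrow> bool" where
  "normal_ballean X Ent \<longleftrightarrow>
     (\<forall>A B. A \<subseteq> X \<and> B \<subseteq> X \<and> asym_disjoint X Ent A B \<longrightarrow>
        (\<exists>U V. U \<subseteq> X \<and> V \<subseteq> X \<and> asym_nbhd X Ent U A \<and> asym_nbhd X Ent V B \<and> U \<inter> V = {}))"

definition ultranormal :: "'b set \<Rightarrow> ('b \<times> 'b) set set \<Rightarrow> bool" where
  "ultranormal X Ent \<longleftrightarrow>
     \<not> (\<exists>A B. A \<subseteq> X \<and> B \<subseteq> X \<and> \<not> bounded_in X Ent A \<and> \<not> bounded_in X Ent B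
             \<and> asym_disjoint X Ent A B)"

text \<open>Cofinality of a family of sets ordered by inclusion: a cofinal subfamily of least
  cardinality. Two cofinalities are equal iff minimal cofinal subfamilies are equipollent.\<close>

definition cofinal_in :: "'c set set \<Rightarrow> 'c set set \<Rightarrow> bool" where
  "cofinal_in P C \<longleftrightarrow> C \<subseteq> P \<and> (\<forall>p\<in>P. \<exists>c\<in>C. p \<subseteq> c)"

definition min_cofinal :: "'c set set \<Rightarrow> 'c set set \<Rightarrow> bool" where
  "min_cofinal P C \<longleftrightarrow> cofinal_in P C \<and> (\<forall>C'. cofinal_in P C' \<longrightarrow> C \<lesssim> C')"

definition cof_regular :: "'b set \<Rightarrow> ('b \<times> 'b) set set \<Rightarrow> bool" where
  "cof_regular X Ent \<longleftrightarrow>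
     (\<exists>C D. min_cofinal Ent C \<and> min_cofinal (bornology X Ent) D \<and> C \<approx> D)"

definition linearly_ordered_base :: "'b set \<Rightarrow> ('b \<times> 'b) set set \<Rightarrow> bool" where
  "linearly_ordered_base X Ent \<longleftrightarrow>
     (\<exists>L \<subseteq> bornology X Ent. (\<forall>a\<in>L. \<forall>b\<in>L. a \<subseteq> b \<or> b \<subseteq> a) \<and>
        (\<forall>B\<in>bornology X Ent. \<exists>l\<in>L. B \<subseteq> l))"

definition power_pts :: "'b set \<Rightarrow> nat \<Rightarrow> (nat \<Rightarrow> 'b) set" where
  "power_pts X n = PiE {..<n} (\<lambda>_. X)"

definition power_ent :: "'b set \<Rightarrow> ('b \<times> 'b) set set \<Rightarrow> nat \<Rightarrow> ((nat \<Rightarrow> 'b) \<times> (nat \<Rightarrow> 'b)) set set" where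
  "power_ent X Ent n =
     {{(x, y). x \<in> power_pts X n \<and> y \<in> power_pts X n \<and> (\<forall>i<n. (x i, y i) \<in> Es i)} | Es.
        \<forall>i<n. Es i \<in> Ent}"

definition perm_subgroup :: "nat \<Rightarrow> (nat \<Rightarrow> nat) set \<Rightarrow> bool" where
  "perm_subgroup n G \<longleftrightarrow> (\<forall>g\<in>G. g permutes {..<n}) \<and> id \<in> G \<and>
     (\<forall>g\<in>G. \<forall>h\<in>G. g \<circ> h \<in> G) \<and> (\<forall>g\<in>G. inv g \<in> G)"

definition orbit_G :: "(nat \<Rightarrow> nat) set \<Rightarrow> (nat \<Rightarrow> 'b) \<Rightarrow> (nat \<Rightarrow> 'b) set" where
  "orbit_G G x = (\<lambda>g. x \<circ> g) ` G"

definition symp_pts :: "'b set \<Rightarrow> nat \<Rightarrow> (nat \<Rightarrow> nat) set \<Rightarrow> (nat \<Rightarrow> 'b) set set" where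
  "symp_pts X n G = orbit_G G ` power_pts X n"

definition symp_ent :: "'b set \<Rightarrow> ('b \<times> 'b) set set \<Rightarrow> nat \<Rightarrow> (nat \<Rightarrow> nat) set
     \<Rightarrow> ((nat \<Rightarrow> 'b) set \<times> (nat \<Rightarrow> 'b) set) set set" where
  "symp_ent X Ent n G = (\<lambda>e. (\<lambda>(x, y). (orbit_G G x, orbit_G G y)) ` e) ` power_ent X Ent n"

definition hyper_pts :: "'b set \<Rightarrow> ('b \<times> 'b) set set \<Rightarrow> 'b set set" where
  "hyper_pts X Ent = bornology X Ent - {{}}"

definition hyper_ent :: "'b set \<Rightarrow> ('b \<times> 'b) set set \<Rightarrow> ('b set \<times> 'b set) set set" where
  "hyper_ent X Ent = (\<lambda>e. {(A, B). A \<in> hyper_pts X Ent \<and> B \<in> hyper_pts X Ent \<and>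
                              A \<subseteq> e `` B \<and> B \<subseteq> e `` A}) ` Ent"

definition hyper_le_pts :: "'b set \<Rightarrow> ('b \<times> 'b) set set \<Rightarrow> nat \<Rightarrow> 'b set set" where
  "hyper_le_pts X Ent n = {A \<in> hyper_pts X Ent. finite A \<and> card A \<le> n}"

definition hyper_le_ent :: "'b set \<Rightarrow> ('b \<times> 'b) set set \<Rightarrow> nat \<Rightarrow> ('b set \<times> 'b set) set set" where
  "hyper_le_ent X Ent n =
     (\<lambda>e. e \<inter> (hyper_le_pts X Ent n \<times> hyper_le_pts X Ent n)) ` hyper_ent X Ent"

end

(*
  Each ballean Y built from X attaches to a point y a support in X such that a subset of Y is
  bounded iff the union of the supports of its points is, and Y has a cofinal family of
  entourages indexed monotonically by those of X.

  Let kappa = cof(B_X) = cof(E_X). A linearly ordered base exists iff unions of fewer than kappa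
  bounded sets are bounded. In that case enumerate cofinal entourages E_i, i < kappa. For
  asymptotically disjoint S, T let M_i be the (bounded) union of E_i[S] \<inter> E_j[T] and
  E_j[S] \<inter> E_i[T] over j \<le> i; removing M_i from E_i[S] and from E_i[T] and taking unions over i
  gives disjoint asymptotic neighborhoods.

  Conversely, let Y contain points k(x, y) with support between {x, y} and {x, y, p}. If k(A, p)
  and k(p, B) are asymptotically disjoint in a normal Y, disjoint neighborhoods of them yield a
  function h on bounded sets with: for all bounded K, K', either K' \<inter> A \<subseteq> h(K) or
  K \<inter> B \<subseteq> h(K'). For A = B = X this forces unions of fewer than kappa bounded sets to be
  bounded; this applies to k = (x, y, p, ...) in X^n and to k = [x, x, y, p, ...] in [X]^n_G,
  n \<ge> 3. If X has unbounded asymptotically disjoint A, B, then X embeds in Y and is normal, so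
  A, B have disjoint neighborhoods U, V, and the functions h for the pairs (A, X - U), (B, X - V)
  and (A, B) suffice, because X - U and X - V cover X.
*)
theory Submission
  imports Defs
begin

section \<open>Balleans with a base point\<close>

text \<open>Finite families count as small, so that a bounded ballean, whose bornology has
  cofinality \<open>1\<close>, needs no separate treatment.\<close>

definition small :: "'d set \<Rightarrow> 'b set \<Rightarrow> bool" where
  "small D F \<longleftrightarrow> finite F \<or> \<not> D \<lesssim> F"

section \<open>Small families and well-orders with small initial segments\<close>

lemma small_image: "small D F \<Longrightarrow> small D (h ` F)"
  unfolding small_def using lepoll_trans[OF _ image_lepoll[of h F]] by auto

lemma small_subset: "small D F \<Longrightarrow> E \<subseteq> F \<Longrightarrow> small D E"
  unfolding small_def by (metis finite_subset lepoll_trans subset_imp_lepoll)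

text \<open>\<open>R\<close> replaces the enumeration by ordinals below kappa: it is a well-order of
  \<open>D\<close> of least possible order type, so each proper initial segment has smaller
  cardinality than \<open>D\<close>.\<close>

lemma small_order:
  obtains R where "\<forall>x\<in>D. \<forall>y\<in>D. R x y \<or> R y x" "\<forall>x y z. R x y \<longrightarrow> R y z \<longrightarrow> R x z"
    "\<forall>d\<in>D. small D {x \<in> D. R x d}"
proof (rule that; intro ballI allI impI)
  let ?r = "card_of D"
  have wo: "well_order_on D ?r" by (rule card_of_well_order_on)
  have F: "Field ?r = D" and CO: "Card_order ?r"
    by (rule Field_card_of, rule card_of_Card_order)
  have total: "total_on D ?r" and refl: "refl_on D ?r" and trans: "trans ?r" and anti: "antisym ?r"
    using wo unfolding well_order_on_def linear_order_on_def partial_order_on_def preorder_on_def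
    by auto
  show "(x, y) \<in> ?r \<or> (y, x) \<in> ?r" if "x \<in> D" "y \<in> D" for x y
    using total refl that unfolding total_on_def refl_on_def by (cases "x = y") auto
  show "(x, z) \<in> ?r" if "(x, y) \<in> ?r" "(y, z) \<in> ?r" for x y z
    using trans that by (rule transD)
  show "small D {x \<in> D. (x, d) \<in> ?r}" if d: "d \<in> D" for d
  proof (cases "finite D")
    case True
    then show ?thesis by (simp add: small_def)
  next
    case False
    \<comment> \<open>An infinite cardinal order has no last element, so the closed segment below
      \<open>d\<close> fits into the strict segment below a later \<open>d'\<close>.\<close>
    then obtain d' where d': "d' \<in> D" "d \<noteq> d'" "(d, d') \<in> ?r"
      using infinite_Card_order_limit[OF CO] d F by metis
    have "\<not> D \<lesssim> underS ?r d'"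
      using card_of_underS[OF CO] d' F card_of_ordLess[of D "underS ?r d'"] unfolding lepoll_def
      by blast
    then have "small D (underS ?r d')" by (simp add: small_def)
    moreover have "{x \<in> D. (x, d) \<in> ?r} \<subseteq> underS ?r d'"
    proof
      fix x assume "x \<in> {x \<in> D. (x, d) \<in> ?r}"
      then show "x \<in> underS ?r d'"
        using d' transD[OF trans, of x d d'] antisymD[OF anti, of d d'] by (auto simp: underS_def)
    qed
    ultimately show ?thesis by (rule small_subset)
  qed
qed

locale pointed_ballean =
  fixes X :: "'a set" and Ent :: "('a \<times> 'a) set set" and p :: 'a
  assumes is_ballean: "ballean X Ent" and base_point: "p \<in> X"
begin

abbreviation bd :: "'a set \<Rightarrow> bool" where "bd \<equiv> bounded_in X Ent"

section \<open>Calculus of entourages\<close>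

lemma ent_sub:
  assumes "e \<in> Ent" "(x, y) \<in> e" shows "x \<in> X \<and> y \<in> X"
proof -
  have "e \<subseteq> X \<times> X" using is_ballean assms(1) unfolding ballean_def by simp
  then show ?thesis using assms(2) by auto
qed

lemma ent_refl:
  assumes "e \<in> Ent" "x \<in> X" shows "(x, x) \<in> e"
proof -
  have "Id_on X \<subseteq> e" using is_ballean assms(1) unfolding ballean_def by simp
  then show ?thesis using assms(2) by auto
qed

lemma ent_diff:
  assumes "e \<in> Ent" "f \<in> Ent"
  obtains d where "d \<in> Ent" "\<And>x y z. (x, y) \<in> e \<Longrightarrow> (z, y) \<in> f \<Longrightarrow> (x, z) \<in> d"
proof -
  obtain d where d: "d \<in> Ent" "e O f\<inverse> \<subseteq> d"
    using is_ballean assms unfolding ballean_def by metis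
  have "(x, z) \<in> d" if "(x, y) \<in> e" "(z, y) \<in> f" for x y z
    using relcompI[OF that(1) converseI[OF that(2)]] d(2) by (rule subsetD[rotated])
  then show thesis using that d(1) by metis
qed

text \<open>Bounding \<open>e O converse e\<close> suffices: composing with the diagonal on either
  side recovers \<open>e\<close> and its converse inside one entourage.\<close>

lemma ent_sym:
  assumes "e \<in> Ent"
  obtains d where "d \<in> Ent" "\<And>x y. (x, y) \<in> e \<Longrightarrow> (x, y) \<in> d \<and> (y, x) \<in> d"
proof -
  obtain d where d: "d \<in> Ent" "\<And>x y z. (x, y) \<in> e \<Longrightarrow> (z, y) \<in> e \<Longrightarrow> (x, z) \<in> d"
    using ent_diff assms by blast
  have "(x, y) \<in> d \<and> (y, x) \<in> d" if "(x, y) \<in> e" for x y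
    using d(2) that ent_refl[OF assms, of y] ent_sub[OF assms that] by blast
  then show thesis using that d(1) by blast
qed

lemma ent_comp:
  assumes "e \<in> Ent" "f \<in> Ent"
  obtains d where "d \<in> Ent" "\<And>x y z. (x, y) \<in> e \<Longrightarrow> (y, z) \<in> f \<Longrightarrow> (x, z) \<in> d"
proof -
  obtain f' where f': "f' \<in> Ent" "\<And>x y. (x, y) \<in> f \<Longrightarrow> (x, y) \<in> f' \<and> (y, x) \<in> f'"
    using ent_sym assms by blast
  obtain d where "d \<in> Ent" "\<And>x y z. (x, y) \<in> e \<Longrightarrow> (z, y) \<in> f' \<Longrightarrow> (x, z) \<in> d"
    using ent_diff[OF assms(1) f'(1)] by blast
  then show thesis using that f'(2) by blast
qed

lemma ent_union:
  assumes "e \<in> Ent" "f \<in> Ent"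
  obtains d where "d \<in> Ent" "e \<subseteq> d" "f \<subseteq> d"
proof -
  obtain d where d: "d \<in> Ent" "\<And>x y z. (x, y) \<in> e \<Longrightarrow> (y, z) \<in> f \<Longrightarrow> (x, z) \<in> d"
    using ent_comp assms by blast
  have "e \<subseteq> d"
    by (rule subrelI) (use d(2) ent_sub[OF assms(1)] ent_refl[OF assms(2)] in blast)
  moreover have "f \<subseteq> d"
    by (rule subrelI) (use d(2) ent_sub[OF assms(2)] ent_refl[OF assms(1)] in blast)
  ultimately show thesis using that d(1) by blast
qed

lemma ent_connected:
  assumes "x \<in> X" "y \<in> X" obtains e where "e \<in> Ent" "(x, y) \<in> e"
proof -
  have "(x, y) \<in> \<Union>Ent" using is_ballean assms unfolding ballean_def by simp
  then show thesis using that by blast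
qed

lemma ent_nonempty: "\<exists>e. e \<in> Ent"
  by (rule ent_connected[OF base_point base_point]) blast

text \<open>Since entourages cover \<open>X \<times> X\<close>, one of them links \<open>p\<close>
  to any other centre, so all balls can be centred at \<open>p\<close>. Both directions are recorded
  to match \<open>hat_centre\<close>.\<close>

lemma bd_iff: "bd B \<longleftrightarrow> (\<exists>e\<in>Ent. \<forall>x\<in>B. (p, x) \<in> e \<and> (x, p) \<in> e)"
proof
  assume "bd B"
  then obtain e x where e: "e \<in> Ent" "x \<in> X" "B \<subseteq> e `` {x}"
    unfolding bounded_in_def by blast
  obtain f where f: "f \<in> Ent" "(p, x) \<in> f" using ent_connected e(2) base_point by metis
  obtain d where d: "d \<in> Ent" "\<And>x y z. (x, y) \<in> f \<Longrightarrow> (y, z) \<in> e \<Longrightarrow> (x, z) \<in> d"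
    using ent_comp e f by blast
  obtain d' where d': "d' \<in> Ent" "\<And>x y. (x, y) \<in> d \<Longrightarrow> (x, y) \<in> d' \<and> (y, x) \<in> d'"
    using ent_sym d by blast
  have "(p, y) \<in> d" if "y \<in> B" for y using that d(2)[OF f(2)] e(3) by blast
  then show "\<exists>e\<in>Ent. \<forall>x\<in>B. (p, x) \<in> e \<and> (x, p) \<in> e" using d' by blast
next
  assume "\<exists>e\<in>Ent. \<forall>x\<in>B. (p, x) \<in> e \<and> (x, p) \<in> e"
  then show "bd B" unfolding bounded_in_def using base_point by blast
qed

lemma bd_subset: "bd B \<Longrightarrow> A \<subseteq> B \<Longrightarrow> bd A"
  unfolding bounded_in_def by blast

lemma bd_sub_carrier: "bd B \<Longrightarrow> B \<subseteq> X"
  unfolding bounded_in_def using ent_sub by blast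

lemma bd_empty: "bd {}"
  unfolding bd_iff using ent_nonempty by blast

lemma bd_Un:
  assumes "bd A" "bd B" shows "bd (A \<union> B)"
proof -
  obtain e f where e: "e \<in> Ent" "\<forall>x\<in>A. (p, x) \<in> e \<and> (x, p) \<in> e"
    and f: "f \<in> Ent" "\<forall>x\<in>B. (p, x) \<in> f \<and> (x, p) \<in> f"
    using assms unfolding bd_iff by blast
  obtain d where "d \<in> Ent" "e \<subseteq> d" "f \<subseteq> d" by (rule ent_union[OF e(1) f(1)])
  moreover then have "\<forall>x\<in>A \<union> B. (p, x) \<in> d \<and> (x, p) \<in> d" using e(2) f(2) by auto
  ultimately show ?thesis unfolding bd_iff by auto
qed

lemma bd_singleton: "x \<in> X \<Longrightarrow> bd {x}"
  unfolding bounded_in_def using ent_nonempty ent_refl by blast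

lemma bd_finite: "finite A \<Longrightarrow> A \<subseteq> X \<Longrightarrow> bd A"
proof (induction A rule: finite_induct)
  case (insert x A)
  then show ?case using bd_Un[of "{x}" A] bd_singleton[of x] by simp
qed (rule bd_empty)

lemma bd_Union_finite: "finite F \<Longrightarrow> (\<And>B. B \<in> F \<Longrightarrow> bd B) \<Longrightarrow> bd (\<Union>F)"
  by (induction F rule: finite_induct) (auto simp: bd_empty bd_Un)

lemma bd_Image:
  assumes "e \<in> Ent" "bd B" shows "bd ((e \<union> e\<inverse>) `` B)"
proof -
  obtain f where f: "f \<in> Ent" "\<forall>x\<in>B. (p, x) \<in> f" using assms unfolding bd_iff by blast
  obtain e' where e': "e' \<in> Ent" "\<And>x y. (x, y) \<in> e \<Longrightarrow> (x, y) \<in> e' \<and> (y, x) \<in> e'"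
    using ent_sym assms by blast
  obtain d where d: "d \<in> Ent" "\<And>x y z. (x, y) \<in> f \<Longrightarrow> (y, z) \<in> e' \<Longrightarrow> (x, z) \<in> d"
    using ent_comp[OF f(1) e'(1)] by blast
  have "(e \<union> e\<inverse>) `` B \<subseteq> d `` {p}" using f(2) e'(2) d(2) by blast
  then show ?thesis using d(1) base_point unfolding bounded_in_def by blast
qed

section \<open>Cofinality of the bornology and linearly ordered bases\<close>

lemma min_cofinal_bornologyD:
  assumes "min_cofinal (bornology X Ent) D"
  shows "B \<in> D \<Longrightarrow> bd B" "bd B \<Longrightarrow> \<exists>d\<in>D. B \<subseteq> d"
  using assms unfolding min_cofinal_def cofinal_in_def bornology_def by (blast, simp)

text \<open>Applied to families of bounded sets into which \<open>D\<close> does not inject: such a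
  family misses some bounded set.\<close>

lemma min_cofinal_bornology_lepoll:
  assumes "min_cofinal (bornology X Ent) D" "\<forall>B\<in>S. bd B" "\<forall>B. bd B \<longrightarrow> (\<exists>d\<in>S. B \<subseteq> d)"
  shows "D \<lesssim> S"
proof -
  have "cofinal_in (bornology X Ent) S"
    unfolding cofinal_in_def bornology_def by (intro conjI subsetI ballI CollectI)
      (use assms(2,3) in auto)
  then show ?thesis using assms(1) unfolding min_cofinal_def by simp
qed

lemma linearly_ordered_baseE:
  assumes "linearly_ordered_base X Ent"
  obtains L where "\<forall>a\<in>L. bd a" "\<forall>a\<in>L. \<forall>b\<in>L. a \<subseteq> b \<or> b \<subseteq> a" "\<forall>B. bd B \<longrightarrow> (\<exists>l\<in>L. B \<subseteq> l)"
  using assms unfolding linearly_ordered_base_def bornology_def by auto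

lemma linearly_ordered_baseI:
  assumes "\<And>a. a \<in> L \<Longrightarrow> bd a" "\<And>a b. a \<in> L \<Longrightarrow> b \<in> L \<Longrightarrow> a \<subseteq> b \<or> b \<subseteq> a"
    "\<And>B. bd B \<Longrightarrow> \<exists>l\<in>L. B \<subseteq> l"
  shows "linearly_ordered_base X Ent"
  unfolding linearly_ordered_base_def bornology_def
  by (intro exI[of _ L] conjI ballI subsetI CollectI) (use assms in auto)

text \<open>Members \<open>l B\<close> of the chain chosen above the sets of \<open>F\<close> form a
  family too small to be cofinal. A member \<open>m\<close> above a bounded set that escapes all of
  them must, by linearity, lie above every \<open>l B\<close>.\<close>

lemma linear_base_bd_Union:
  assumes D: "min_cofinal (bornology X Ent) D" and "linearly_ordered_base X Ent"
    and F: "small D F" "\<And>B. B \<in> F \<Longrightarrow> bd B"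
  shows "bd (\<Union>F)"
proof (cases "finite F")
  case True
  then show ?thesis using bd_Union_finite F(2) by simp
next
  case False
  obtain L where L: "\<forall>a\<in>L. bd a" "\<forall>a\<in>L. \<forall>b\<in>L. a \<subseteq> b \<or> b \<subseteq> a"
    "\<forall>B. bd B \<longrightarrow> (\<exists>l\<in>L. B \<subseteq> l)"
    using assms(2) by (rule linearly_ordered_baseE)
  obtain l where l: "\<And>B. B \<in> F \<Longrightarrow> l B \<in> L \<and> B \<subseteq> l B" using L(3) F(2) by metis
  have "\<not> D \<lesssim> l ` F"
    using F(1) False lepoll_trans[OF _ image_lepoll[of l F]] unfolding small_def by auto
  moreover have "\<forall>B\<in>l ` F. bd B" using L(1) l by auto
  ultimately obtain B where B: "bd B" "\<forall>d\<in>l ` F. \<not> B \<subseteq> d"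
    using min_cofinal_bornology_lepoll[OF D, of "l ` F"] by metis
  obtain m where m: "m \<in> L" "B \<subseteq> m" using L(3) B(1) by metis
  have "A \<subseteq> m" if "A \<in> F" for A
    using L(2) l[OF that] m B(2) that by (metis imageI order_trans)
  then have "\<Union>F \<subseteq> m" by auto
  then show ?thesis using bd_subset[of m] L(1) m(1) by simp
qed

text \<open>The base consists of the partial unions of \<open>D\<close> along a well-order with
  small initial segments; these form a chain, and each contains its own index
  \<open>d\<close>.\<close>

lemma linear_base_if_bd_Union:
  assumes D: "min_cofinal (bornology X Ent) D"
    and add: "\<And>F. small D F \<Longrightarrow> (\<And>B. B \<in> F \<Longrightarrow> bd B) \<Longrightarrow> bd (\<Union>F)"
  shows "linearly_ordered_base X Ent"
proof -
  obtain R where R: "\<forall>x\<in>D. \<forall>y\<in>D. R x y \<or> R y x" "\<forall>x y z. R x y \<longrightarrow> R y z \<longrightarrow> R x z"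
    "\<forall>d\<in>D. small D {x \<in> D. R x d}"
    by (rule small_order)
  let ?u = "\<lambda>d. \<Union>{x \<in> D. R x d}"
  show ?thesis
  proof (rule linearly_ordered_baseI[of "?u ` D"])
    show "bd a" if "a \<in> ?u ` D" for a
      using that R(3) min_cofinal_bornologyD(1)[OF D] by (auto intro!: add)
    have mono: "?u c \<subseteq> ?u d" if "R c d" for c d
      using R(2) that by auto
    show "a \<subseteq> b \<or> b \<subseteq> a" if ab: "a \<in> ?u ` D" "b \<in> ?u ` D" for a b
    proof -
      obtain c d where cd: "c \<in> D" "d \<in> D" "a = ?u c" "b = ?u d" using ab by blast
      then have "R c d \<or> R d c" using R(1) by simp
      then show ?thesis using mono unfolding cd by (elim disjE) simp_all
    qed
    show "\<exists>l\<in>?u ` D. B \<subseteq> l" if B: "bd B" for B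
    proof -
      obtain d where d: "d \<in> D" "B \<subseteq> d" using min_cofinal_bornologyD(2)[OF D B] by blast
      then have "B \<subseteq> ?u d" using R(1) by auto
      then show ?thesis using d(1) by blast
    qed
  qed
qed

text \<open>For infinite small \<open>F\<close>, the sets \<open>h A\<close> with \<open>A\<close>
  in \<open>F\<close> are too few to be cofinal. A bounded \<open>B\<close> contained in none of
  them forces the other alternative for every \<open>A\<close>, so one set \<open>h B\<close> covers
  all of \<open>F\<close>.\<close>

lemma linear_base_if_dichotomy:
  assumes D: "min_cofinal (bornology X Ent) D"
    and h: "\<And>B. bd B \<Longrightarrow> bd (h B)"
    and dich: "\<And>B B'. bd B \<Longrightarrow> bd B' \<Longrightarrow> B' \<subseteq> h B \<or> B \<subseteq> h B'"
  shows "linearly_ordered_base X Ent"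
proof (rule linear_base_if_bd_Union[OF D])
  fix F assume F: "small D F" "\<And>B. B \<in> F \<Longrightarrow> bd B"
  show "bd (\<Union>F)"
  proof (cases "finite F")
    case True
    then show ?thesis using bd_Union_finite F(2) by simp
  next
    case False
    have "\<not> D \<lesssim> h ` F"
      using F(1) False lepoll_trans[OF _ image_lepoll[of h F]] unfolding small_def by auto
    moreover have "\<forall>B\<in>h ` F. bd B" using h F(2) by auto
    ultimately obtain B where B: "bd B" "\<forall>A\<in>h ` F. \<not> B \<subseteq> A"
      using min_cofinal_bornology_lepoll[OF D, of "h ` F"] by metis
    have "A \<subseteq> h B" if "A \<in> F" for A
      using dich[OF B(1) F(2)[OF that]] B(2) that by auto
    then have "\<Union>F \<subseteq> h B" by auto
    then show ?thesis using bd_subset[OF h[OF B(1)]] by simp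
  qed
qed

end

section \<open>Balleans derived from \<open>X\<close>\<close>

text \<open>Entourages need not be symmetric, hence the symmetrizations in \<open>hat_supp\<close> and
  \<open>hat_centre\<close>.\<close>

locale derived_ballean = pointed_ballean X Ent p
  for X :: "'a set" and Ent :: "('a \<times> 'a) set set" and p :: 'a +
  fixes Y :: "'y set" and F :: "('y \<times> 'y) set set" and supp :: "'y \<Rightarrow> 'a set"
    and hat :: "('a \<times> 'a) set \<Rightarrow> ('y \<times> 'y) set" and c :: 'y
  assumes hat_in: "e \<in> Ent \<Longrightarrow> hat e \<in> F"
    and hat_cofinal: "f \<in> F \<Longrightarrow> \<exists>e\<in>Ent. f \<subseteq> hat e"
    and hat_mono: "e \<subseteq> d \<Longrightarrow> hat e \<subseteq> hat d"
    and hat_supp: "(y, z) \<in> hat e \<Longrightarrow> y \<in> Y \<and> z \<in> Y \<and>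
      supp y \<subseteq> (e \<union> e\<inverse>) `` supp z \<and> supp z \<subseteq> (e \<union> e\<inverse>) `` supp y"
    and supp_bounded: "y \<in> Y \<Longrightarrow> bounded_in X Ent (supp y)"
    and centre: "c \<in> Y"
    and hat_centre: "e \<in> Ent \<Longrightarrow> y \<in> Y \<Longrightarrow> \<forall>x\<in>supp y. (p, x) \<in> e \<and> (x, p) \<in> e \<Longrightarrow> (c, y) \<in> hat e"
begin

section \<open>Boundedness and asymptotic notions of \<open>Y\<close> in terms of supports\<close>

abbreviation bdY :: "'y set \<Rightarrow> bool" where "bdY \<equiv> bounded_in Y F"

lemma hat_sub: "(y, z) \<in> hat e \<Longrightarrow> y \<in> Y \<and> z \<in> Y"
  using hat_supp by blast

lemma hat_supp_left:
  assumes "(y, z) \<in> hat e" "x \<in> supp y" shows "\<exists>w\<in>supp z. (x, w) \<in> e \<or> (w, x) \<in> e"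
proof -
  have "x \<in> (e \<union> e\<inverse>) `` supp z" using hat_supp[OF assms(1)] assms(2) by (auto dest: subsetD)
  then show ?thesis by auto
qed

lemma hat_supp_right:
  assumes "(y, z) \<in> hat e" "x \<in> supp z" shows "\<exists>w\<in>supp y. (x, w) \<in> e \<or> (w, x) \<in> e"
proof -
  have "x \<in> (e \<union> e\<inverse>) `` supp y" using hat_supp[OF assms(1)] assms(2) by (auto dest: subsetD)
  then show ?thesis by auto
qed

text \<open>A ball around \<open>y\<close> has its supports in a bounded neighborhood of
  \<open>supp y\<close>; conversely, \<open>hat_centre\<close> puts points with jointly bounded
  supports into one ball around \<open>c\<close>.\<close>

lemma bdY_iff: "bdY T \<longleftrightarrow> T \<subseteq> Y \<and> bd (\<Union>(supp ` T))"
proof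
  assume "bdY T"
  then obtain f y where f: "f \<in> F" "y \<in> Y" "T \<subseteq> f `` {y}"
    unfolding bounded_in_def[of Y] by blast
  obtain e where e: "e \<in> Ent" "f \<subseteq> hat e" using hat_cofinal f(1) by blast
  have T: "(y, t) \<in> hat e" if "t \<in> T" for t using that f(3) e(2) by auto
  have "\<Union>(supp ` T) \<subseteq> (e \<union> e\<inverse>) `` supp y" using hat_supp[OF T] by blast
  then have "bd (\<Union>(supp ` T))"
    by (rule bd_subset[rotated]) (rule bd_Image[OF e(1) supp_bounded[OF f(2)]])
  then show "T \<subseteq> Y \<and> bd (\<Union>(supp ` T))" using hat_sub[OF T] by auto
next
  assume T: "T \<subseteq> Y \<and> bd (\<Union>(supp ` T))"
  then obtain e where e: "e \<in> Ent" "\<forall>x\<in>\<Union>(supp ` T). (p, x) \<in> e \<and> (x, p) \<in> e"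
    unfolding bd_iff by blast
  have "(c, t) \<in> hat e" if "t \<in> T" for t
    by (rule hat_centre) (use T e that in auto)
  then have "T \<subseteq> hat e `` {c}" by auto
  then show "bdY T" unfolding bounded_in_def[of Y] using hat_in[OF e(1)] centre by auto
qed

lemma asym_disjointI:
  assumes "\<And>e. e \<in> Ent \<Longrightarrow> bd (\<Union>(supp ` (hat e `` S \<inter> hat e `` T)))"
  shows "asym_disjoint Y F S T"
  unfolding asym_disjoint_def
proof
  fix f assume "f \<in> F"
  then obtain e where e: "e \<in> Ent" "f \<subseteq> hat e" using hat_cofinal by blast
  have "f `` S \<inter> f `` T \<subseteq> Y" using hat_sub e(2) by blast
  moreover have "\<Union>(supp ` (f `` S \<inter> f `` T)) \<subseteq> \<Union>(supp ` (hat e `` S \<inter> hat e `` T))"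
    using e(2) by blast
  ultimately show "bdY (f `` S \<inter> f `` T)"
    unfolding bdY_iff using assms[OF e(1)] bd_subset by blast
qed

lemma asym_disjointD:
  assumes "asym_disjoint Y F S T" "e \<in> Ent"
  shows "bd (\<Union>(supp ` (hat e `` S \<inter> hat e `` T)))"
  using assms hat_in bdY_iff unfolding asym_disjoint_def by blast

lemma asym_nbhdD:
  assumes "asym_nbhd Y F U S" "e \<in> Ent"
  shows "bd (\<Union>(supp ` (hat e `` S - U)))"
  using assms hat_in bdY_iff unfolding asym_nbhd_def by blast

lemma asym_nbhdI:
  assumes "\<And>e. e \<in> Ent \<Longrightarrow> bd (\<Union>(supp ` (hat e `` S - U)))"
  shows "asym_nbhd Y F U S"
  unfolding asym_nbhd_def
proof
  fix f assume "f \<in> F"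
  then obtain e where e: "e \<in> Ent" "f \<subseteq> hat e" using hat_cofinal by blast
  have "f `` S - U \<subseteq> Y" using hat_sub e(2) by blast
  moreover have "\<Union>(supp ` (f `` S - U)) \<subseteq> \<Union>(supp ` (hat e `` S - U))"
    using e(2) by blast
  ultimately show "bdY (f `` S - U)"
    unfolding bdY_iff using assms[OF e(1)] bd_subset by blast
qed

text \<open>Equality of the cofinalities lets the cofinal entourages be indexed by \<open>D\<close>
  itself, so that initial segments of the index set are small with respect to the bornology.\<close>

lemma normal_if_linear_base:
  assumes D: "min_cofinal (bornology X Ent) D" and C: "min_cofinal Ent C" and "C \<approx> D"
    and L: "linearly_ordered_base X Ent"
  shows "normal_ballean Y F"
  unfolding normal_ballean_def
proof (intro allI impI)
  fix S T assume ST: "S \<subseteq> Y \<and> T \<subseteq> Y \<and> asym_disjoint Y F S T"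
  obtain en where en: "bij_betw en D C"
    using eqpoll_sym[OF assms(3)] unfolding eqpoll_def by blast
  have en_Ent: "en i \<in> Ent" if "i \<in> D" for i
    using C bij_betw_apply[OF en that] unfolding min_cofinal_def cofinal_in_def by blast
  have en_cofinal: "\<exists>i\<in>D. e \<subseteq> en i" if "e \<in> Ent" for e
    using C that bij_betw_imp_surj_on[OF en] unfolding min_cofinal_def cofinal_in_def by blast
  obtain R where R: "\<forall>x\<in>D. \<forall>y\<in>D. R x y \<or> R y x" "\<forall>x y z. R x y \<longrightarrow> R y z \<longrightarrow> R x z"
    "\<forall>d\<in>D. small D {x \<in> D. R x d}"
    by (rule small_order)
  define K where "K i j = \<Union>(supp ` (hat (en i) `` S \<inter> hat (en j) `` T))" for i j
  have bdK: "bd (K i j)" if ij: "i \<in> D" "j \<in> D" for i j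
  proof -
    obtain d where d: "d \<in> Ent" "en i \<subseteq> d" "en j \<subseteq> d"
      by (rule ent_union[OF en_Ent[OF ij(1)] en_Ent[OF ij(2)]])
    have "K i j \<subseteq> \<Union>(supp ` (hat d `` S \<inter> hat d `` T))"
      unfolding K_def using hat_mono[OF d(2)] hat_mono[OF d(3)] by blast
    then show ?thesis using asym_disjointD[OF _ d(1)] ST bd_subset by blast
  qed
  \<comment> \<open>Both orders of the indices occur, since either of the two entourages may come
    later.\<close>
  define M where "M i = \<Union>((\<lambda>j. K i j \<union> K j i) ` {x \<in> D. R x i})" for i
  have bdM: "bd (M i)" if i: "i \<in> D" for i
    unfolding M_def
    by (rule linear_base_bd_Union[OF D L small_image]) (use R(3) i bdK bd_Un in auto)
  \<comment> \<open>A point is removed only if its whole support lies in \<open>M i\<close>. Hence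
    the removed points are bounded, while one point left outside is enough to contradict containment
    of the support in \<open>M i\<close>.\<close>
  define U where "U = (\<Union>i\<in>D. {y \<in> hat (en i) `` S. \<not> supp y \<subseteq> M i})"
  define V where "V = (\<Union>i\<in>D. {y \<in> hat (en i) `` T. \<not> supp y \<subseteq> M i})"
  have "U \<subseteq> Y" "V \<subseteq> Y" unfolding U_def V_def using hat_sub by blast+
  moreover have "asym_nbhd Y F U S"
  proof (rule asym_nbhdI)
    fix e assume "e \<in> Ent"
    then obtain i where i: "i \<in> D" "e \<subseteq> en i" using en_cofinal by blast
    have "\<Union>(supp ` (hat e `` S - U)) \<subseteq> M i"
      unfolding U_def using i hat_mono[OF i(2)] by blast
    then show "bd (\<Union>(supp ` (hat e `` S - U)))" using bdM[OF i(1)] bd_subset by blast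
  qed
  moreover have "asym_nbhd Y F V T"
  proof (rule asym_nbhdI)
    fix e assume "e \<in> Ent"
    then obtain i where i: "i \<in> D" "e \<subseteq> en i" using en_cofinal by blast
    have "\<Union>(supp ` (hat e `` T - V)) \<subseteq> M i"
      unfolding V_def using i hat_mono[OF i(2)] by blast
    then show "bd (\<Union>(supp ` (hat e `` T - V)))" using bdM[OF i(1)] bd_subset by blast
  qed
  moreover have "U \<inter> V = {}"
  proof (rule ccontr)
    assume "U \<inter> V \<noteq> {}"
    then obtain y where "y \<in> U" "y \<in> V" by blast
    then obtain i j where y: "i \<in> D" "y \<in> hat (en i) `` S" "\<not> supp y \<subseteq> M i"
      "j \<in> D" "y \<in> hat (en j) `` T" "\<not> supp y \<subseteq> M j"
      unfolding U_def V_def UN_iff mem_Collect_eq by (elim bexE conjE) rule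
    \<comment> \<open>A common point has its support in \<open>K i j\<close>, which the later of the
      two indices has already absorbed into its \<open>M\<close>.\<close>
    have K: "supp y \<subseteq> K i j" unfolding K_def using y(2,5) by blast
    have "R i j \<or> R j i" using R(1) y(1,4) by blast
    then show False
    proof
      assume "R i j"
      then have "K i j \<subseteq> M j" unfolding M_def using y(1) by blast
      then show False using K y(6) by blast
    next
      assume "R j i"
      then have "K i j \<subseteq> M i" unfolding M_def using y(4) by blast
      then show False using K y(3) by blast
    qed
  qed
  ultimately show "\<exists>U V. U \<subseteq> Y \<and> V \<subseteq> Y \<and> asym_nbhd Y F U S \<and> asym_nbhd Y F V T \<and> U \<inter> V = {}"
    by (intro exI[of _ U] exI[of _ V] conjI)
qed

text \<open>If \<open>z\<close> is close to \<open>s a\<close> and \<open>t b\<close>, then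
  \<open>a\<close> is close to a point of \<open>supp (t b)\<close>, that is, to \<open>b\<close> or
  to \<open>p\<close>. Asymptotic disjointness bounds \<open>a\<close> in the first case, and
  closeness to \<open>p\<close> does in the second; \<open>z\<close> is then bounded through
  \<open>supp (s a)\<close>.\<close>

lemma supp_asym_disjoint:
  assumes AB: "asym_disjoint X Ent A B"
    and S: "\<And>a. a \<in> A \<Longrightarrow> a \<in> supp (s a) \<and> supp (s a) \<subseteq> {a, p}"
    and T: "\<And>b. b \<in> B \<Longrightarrow> b \<in> supp (t b) \<and> supp (t b) \<subseteq> {b, p}"
  shows "asym_disjoint Y F (s ` A) (t ` B)"
proof (rule asym_disjointI)
  fix e assume e: "e \<in> Ent"
  obtain e' where e': "e' \<in> Ent" "\<And>x y. (x, y) \<in> e \<Longrightarrow> (x, y) \<in> e' \<and> (y, x) \<in> e'"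
    using ent_sym[OF e] by blast
  obtain d where d: "d \<in> Ent" "\<And>x y z. (x, y) \<in> e' \<Longrightarrow> (y, z) \<in> e' \<Longrightarrow> (x, z) \<in> d"
    using ent_comp[OF e'(1) e'(1)] by blast
  \<comment> \<open>The last \<open>{p}\<close> is there because \<open>supp (s a)\<close> may
    contain \<open>p\<close> besides \<open>a\<close>.\<close>
  define N where "N = (d \<union> d\<inverse>) `` (d `` A \<inter> d `` B \<union> {p}) \<union> {p}"
  have "bd (d `` A \<inter> d `` B)" using AB d(1) unfolding asym_disjoint_def by simp
  then have "bd N"
    unfolding N_def by (intro bd_Un bd_Image[OF d(1)] bd_singleton[OF base_point])
  have "\<Union>(supp ` (hat e `` s ` A \<inter> hat e `` t ` B)) \<subseteq> (e' \<union> e'\<inverse>) `` N"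
  proof
    fix x assume "x \<in> \<Union>(supp ` (hat e `` s ` A \<inter> hat e `` t ` B))"
    then obtain z a b where z: "x \<in> supp z" "a \<in> A" "b \<in> B" "(s a, z) \<in> hat e" "(t b, z) \<in> hat e"
      by blast
    note a = S[OF z(2)] and b = T[OF z(3)]
    obtain w where w: "w \<in> supp z" "(a, w) \<in> e'"
      using hat_supp_left[OF z(4)] a e'(2) by metis
    obtain b' where b': "b' \<in> supp (t b)" "(w, b') \<in> e'"
      using hat_supp_right[OF z(5) w(1)] e'(2) by metis
    have ab': "(a, b') \<in> d" using d(2)[OF w(2) b'(2)] .
    have "b \<in> d `` A \<inter> d `` B" if "b' = b"
      using that ab' z(2,3) ent_refl[OF d(1)] ent_sub[OF d(1) ab'] by blast
    then have "b' \<in> d `` A \<inter> d `` B \<union> {p}" using b'(1) b by auto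
    then have aN: "a \<in> N" using ab' unfolding N_def by blast
    obtain v where v: "v \<in> supp (s a)" "(x, v) \<in> e'"
      using hat_supp_right[OF z(4,1)] e'(2) by metis
    have "p \<in> N" unfolding N_def by simp
    then have "v \<in> N" using v(1) a aN by auto
    then show "x \<in> (e' \<union> e'\<inverse>) `` N" using v(2) by auto
  qed
  then show "bd (\<Union>(supp ` (hat e `` s ` A \<inter> hat e `` t ` B)))"
    using bd_Image[OF e'(1) \<open>bd N\<close>] bd_subset by blast
qed

end

section \<open>From normality to a linearly ordered base\<close>

context pointed_ballean
begin

text \<open>A small family of bounded sets whose union has an unbounded trace on \<open>A\<close> would give, through
  \<open>h\<close>, a small cofinal family for the traces on \<open>P\<close> and on \<open>Q\<close>, hence for the whole bornology. An
  unbounded trace on \<open>P\<close> or \<open>Q\<close> is carried over to \<open>A\<close> by \<open>h\<close>.\<close>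

lemma linear_base_if_cover:
  assumes D: "min_cofinal (bornology X Ent) D"
    and h: "\<And>K. bd K \<Longrightarrow> bd (h K)"
    and cover: "X \<subseteq> P \<union> Q"
    and A: "A \<subseteq> X" "\<not> bd A" and B: "B \<subseteq> X" "\<not> bd B"
    and AP: "\<And>K K'. bd K \<Longrightarrow> bd K' \<Longrightarrow> K' \<inter> A \<subseteq> h K \<or> K \<inter> P \<subseteq> h K'"
    and BQ: "\<And>K K'. bd K \<Longrightarrow> bd K' \<Longrightarrow> K' \<inter> B \<subseteq> h K \<or> K \<inter> Q \<subseteq> h K'"
    and AB: "\<And>K K'. bd K \<Longrightarrow> bd K' \<Longrightarrow> K' \<inter> A \<subseteq> h K \<or> K \<inter> B \<subseteq> h K'"
  shows "linearly_ordered_base X Ent"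
proof -
  have trace: "\<exists>E\<in>F. \<not> E \<inter> S \<subseteq> K" if "\<not> bd (\<Union>F \<inter> S)" "bd K" for F S K
  proof (rule ccontr)
    assume "\<not> ?thesis"
    then have "\<Union>F \<inter> S \<subseteq> K" by auto
    then show False using bd_subset[OF that(2)] that(1) by blast
  qed
  have A_small: "bd (\<Union>F \<inter> A)" if F: "small D F" "\<forall>E\<in>F. bd E" for F
  proof (rule ccontr)
    assume nb: "\<not> bd (\<Union>F \<inter> A)"
    \<comment> \<open>\<open>h E\<close> will cover the trace of a bounded set on \<open>P\<close>,
      and \<open>h (h E)\<close> its trace on \<open>Q\<close>.\<close>
    let ?H = "\<lambda>E. h E \<union> h (h E)"
    have "\<not> finite F" using bd_Union_finite[of F] bd_subset[of "\<Union>F" "\<Union>F \<inter> A"] F(2) nb by blast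
    then have "\<not> D \<lesssim> ?H ` F"
      using F(1) lepoll_trans[OF _ image_lepoll[of ?H F]] unfolding small_def by auto
    moreover have "\<forall>E\<in>?H ` F. bd E" using F(2) h bd_Un by auto
    moreover have "\<exists>E\<in>?H ` F. K \<subseteq> E" if K: "bd K" for K
    proof -
      have "\<not> B \<subseteq> h K" using bd_subset[OF h[OF K]] B(2) by auto
      \<comment> \<open>The point \<open>b\<close> passes from \<open>A\<close> to \<open>Q\<close>:
        the large trace of \<open>E\<close> on \<open>A\<close> forces \<open>b\<close> into
        \<open>h E\<close>, and since \<open>b\<close> is outside \<open>h K\<close>, the dichotomy
        for \<open>B\<close> and \<open>Q\<close> applied to \<open>h E\<close> covers the trace of
        \<open>K\<close> on \<open>Q\<close>.\<close>
      then obtain b where b: "b \<in> B" "b \<notin> h K" by auto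
      have bb: "bd {b}" using bd_singleton b(1) B(1) by auto
      obtain E where E: "E \<in> F" "\<not> E \<inter> A \<subseteq> h K \<union> h {b}"
        using trace[OF nb bd_Un[OF h[OF K] h[OF bb]]] by blast
      have bE: "bd E" using F(2) E(1) by simp
      have "b \<in> h E" using AB[OF bb bE] E(2) b(1) by blast
      then have "K \<inter> Q \<subseteq> h (h E)" using BQ[OF K h[OF bE]] b by blast
      moreover have "K \<inter> P \<subseteq> h E" using AP[OF K bE] E(2) by blast
      moreover have "K \<subseteq> X" by (rule bd_sub_carrier[OF K])
      ultimately have "K \<subseteq> ?H E" using cover by blast
      then show ?thesis using E(1) by blast
    qed
    ultimately show False using min_cofinal_bornology_lepoll[OF D, of "?H ` F"] by blast
  qed
  \<comment> \<open>An unbounded trace on \<open>S\<close> cannot fit into \<open>h {a}\<close>, so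
    each \<open>a\<close> lies in some \<open>h E\<close>. Thus \<open>A\<close> would be covered by
    a small family of bounded sets. This serves both \<open>S = P\<close> and
    \<open>S = B\<close>.\<close>
  have no_A: False if F: "small D F" "\<forall>E\<in>F. bd E" and S: "\<not> bd (\<Union>F \<inter> S)"
    and AS: "\<And>K K'. bd K \<Longrightarrow> bd K' \<Longrightarrow> K' \<inter> A \<subseteq> h K \<or> K \<inter> S \<subseteq> h K'" for F S
  proof -
    have "A \<subseteq> \<Union>(h ` F)"
    proof
      fix a assume a: "a \<in> A"
      then have ba: "bd {a}" using bd_singleton A(1) by auto
      obtain E where "E \<in> F" "\<not> E \<inter> S \<subseteq> h {a}" using trace[OF S h[OF ba]] by blast
      then have "a \<in> h E" using AS[of E "{a}"] ba F(2) a by blast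
      then show "a \<in> \<Union>(h ` F)" using \<open>E \<in> F\<close> by blast
    qed
    then have "\<Union>(h ` F) \<inter> A = A" by blast
    moreover have "bd (\<Union>(h ` F) \<inter> A)" by (rule A_small[OF small_image[OF F(1)]]) (use F(2) h in auto)
    ultimately show False using A(2) by simp
  qed
  have P_small: "bd (\<Union>F \<inter> P)" if F: "small D F" "\<forall>E\<in>F. bd E" for F
    using no_A[OF F _ AP] by blast
  have Q_small: "bd (\<Union>F \<inter> Q)" if F: "small D F" "\<forall>E\<in>F. bd E" for F
  proof (rule ccontr)
    assume nb: "\<not> bd (\<Union>F \<inter> Q)"
    \<comment> \<open>No dichotomy links \<open>Q\<close> to \<open>A\<close>, so the trace on
      \<open>Q\<close> is first carried to \<open>B\<close> and from there to
      \<open>A\<close>.\<close>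
    have "B \<subseteq> \<Union>(h ` F)"
    proof
      fix b assume b: "b \<in> B"
      then have bb: "bd {b}" using bd_singleton B(1) by auto
      obtain E where "E \<in> F" "\<not> E \<inter> Q \<subseteq> h {b}" using trace[OF nb h[OF bb]] by blast
      then have "b \<in> h E" using BQ[of E "{b}"] bb F(2) b by blast
      then show "b \<in> \<Union>(h ` F)" using \<open>E \<in> F\<close> by blast
    qed
    then have "\<Union>(h ` F) \<inter> B = B" by blast
    then have "\<not> bd (\<Union>(h ` F) \<inter> B)" using B(2) by simp
    moreover have "\<forall>E\<in>h ` F. bd E" using F(2) h by simp
    ultimately show False using no_A[OF small_image[OF F(1)] _ _ AB] by blast
  qed
  show ?thesis
  proof (rule linear_base_if_bd_Union[OF D])
    fix F assume F: "small D F" "\<And>E. E \<in> F \<Longrightarrow> bd E"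
    have "\<Union>F \<subseteq> \<Union>F \<inter> P \<union> \<Union>F \<inter> Q" using F(2) bd_sub_carrier cover by blast
    then show "bd (\<Union>F)"
      by (rule bd_subset[rotated]) (intro bd_Un P_small Q_small; use F in simp)
  qed
qed

text \<open>A point near both \<open>A\<close> and some \<open>z\<close> outside \<open>U\<close>
  makes \<open>z\<close> itself near \<open>A\<close>, hence a member of the bounded set
  \<open>d[A] - U\<close>.\<close>

lemma asym_disjoint_Diff:
  assumes "asym_nbhd X Ent U A"
  shows "asym_disjoint X Ent A (X - U)"
  unfolding asym_disjoint_def
proof
  fix e assume e: "e \<in> Ent"
  obtain d where d: "d \<in> Ent" "\<And>x y z. (x, y) \<in> e \<Longrightarrow> (z, y) \<in> e \<Longrightarrow> (x, z) \<in> d"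
    using ent_diff[OF e e] by blast
  have "bd ((e \<union> e\<inverse>) `` (d `` A - U))"
    using bd_Image[OF e] assms d(1) unfolding asym_nbhd_def by simp
  moreover have "e `` A \<inter> e `` (X - U) \<subseteq> (e \<union> e\<inverse>) `` (d `` A - U)"
    using d(2) by blast
  ultimately show "bd (e `` A \<inter> e `` (X - U))" by (rule bd_subset)
qed

end

section \<open>Two-parameter probes \<open>k\<close> and the consequences of normality\<close>

locale probed_ballean = derived_ballean X Ent p Y F supp hat c
  for X :: "'a set" and Ent :: "('a \<times> 'a) set set" and p :: 'a
    and Y :: "'y set" and F :: "('y \<times> 'y) set set" and supp :: "'y \<Rightarrow> 'a set"
    and hat :: "('a \<times> 'a) set \<Rightarrow> ('y \<times> 'y) set" and c :: 'y +
  fixes k :: "'a \<Rightarrow> 'a \<Rightarrow> 'y"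
  \<comment> \<open>Closeness is required in both directions because the hyperballean entourages
    compare sets both ways.\<close>
  assumes k_hat: "e \<in> Ent \<Longrightarrow> {(x, x'), (x', x), (y, y'), (y', y)} \<subseteq> e \<Longrightarrow>
      (k x y, k x' y') \<in> hat e"
    and k_supp: "x \<in> X \<Longrightarrow> y \<in> X \<Longrightarrow> {x, y} \<subseteq> supp (k x y) \<and> supp (k x y) \<subseteq> {x, y, p}"
begin

lemma k_in: "x \<in> X \<Longrightarrow> y \<in> X \<Longrightarrow> k x y \<in> Y"
  using ent_nonempty k_hat[of _ x x y y] ent_refl hat_sub by (metis empty_subsetI insert_subset)

text \<open>For \<open>y\<close> in a bounded \<open>K\<close>, the point \<open>k a y\<close> is
  uniformly close to \<open>k a p\<close>, so it lies in \<open>U\<close> unless \<open>a\<close>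
  belongs to a bounded set \<open>h K\<close>; likewise \<open>k y b\<close> lies in
  \<open>V\<close>. If both alternatives failed, some \<open>k a b\<close> would be in
  \<open>U\<close> and in \<open>V\<close>.\<close>

lemma normal_dichotomy:
  assumes "normal_ballean Y F" and AB: "A \<subseteq> X" "B \<subseteq> X"
    and "asym_disjoint Y F ((\<lambda>a. k a p) ` A) (k p ` B)"
  obtains h where "\<forall>K. bd K \<longrightarrow> bd (h K)"
    "\<forall>K K'. bd K \<longrightarrow> bd K' \<longrightarrow> K' \<inter> A \<subseteq> h K \<or> K \<inter> B \<subseteq> h K'"
proof -
  let ?S = "(\<lambda>a. k a p) ` A" and ?T = "k p ` B"
  have "?S \<subseteq> Y" "?T \<subseteq> Y" using AB k_in base_point by auto
  then obtain U V where UV: "asym_nbhd Y F U ?S" "asym_nbhd Y F V ?T" "U \<inter> V = {}"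
    using assms(1,4) unfolding normal_ballean_def by metis
  have "\<exists>N. bd N \<and> (\<forall>y\<in>K. (\<forall>a\<in>A - N. k a y \<in> U) \<and> (\<forall>b\<in>B - N. k y b \<in> V))"
    if K: "bd K" for K
  proof -
    obtain e where e: "e \<in> Ent" "\<forall>x\<in>K. (p, x) \<in> e \<and> (x, p) \<in> e" using K unfolding bd_iff by blast
    \<comment> \<open>The supports of all exceptional points; \<open>a\<close> is in the support of
      \<open>k a y\<close>, so \<open>a\<close> outside \<open>?N\<close> rules out an
      exception.\<close>
    let ?N = "\<Union>(supp ` (hat e `` ?S - U)) \<union> \<Union>(supp ` (hat e `` ?T - V))"
    have "bd ?N" by (intro bd_Un asym_nbhdD[OF UV(1) e(1)] asym_nbhdD[OF UV(2) e(1)])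
    moreover have "k a y \<in> U" if "y \<in> K" "a \<in> A - ?N" for a y
    proof (rule ccontr)
      assume "k a y \<notin> U"
      have X: "a \<in> X" "y \<in> X" using that AB(1) bd_sub_carrier[OF K] by auto
      have "(k a p, k a y) \<in> hat e" using k_hat[OF e(1)] ent_refl[OF e(1) X(1)] e(2) that(1) by simp
      then have "k a y \<in> hat e `` ?S - U" using that(2) \<open>k a y \<notin> U\<close> by auto
      then have "supp (k a y) \<subseteq> ?N" by (intro le_supI1 UN_upper)
      then show False using k_supp[OF X] that(2) by (meson DiffD2 insert_subset subsetD)
    qed
    moreover have "k y b \<in> V" if "y \<in> K" "b \<in> B - ?N" for b y
    proof (rule ccontr)
      assume "k y b \<notin> V"
      have X: "y \<in> X" "b \<in> X" using that AB(2) bd_sub_carrier[OF K] by auto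
      have "(k p b, k y b) \<in> hat e" using k_hat[OF e(1)] ent_refl[OF e(1) X(2)] e(2) that(1) by simp
      then have "k y b \<in> hat e `` ?T - V" using that(2) \<open>k y b \<notin> V\<close> by auto
      then have "supp (k y b) \<subseteq> ?N" by (intro le_supI2 UN_upper)
      then show False using k_supp[OF X] that(2) by (meson DiffD2 insert_subset subsetD)
    qed
    ultimately show ?thesis by (intro exI[of _ ?N] conjI ballI)
  qed
  then obtain h where h: "bd (h K)" "\<forall>y\<in>K. (\<forall>a\<in>A - h K. k a y \<in> U) \<and> (\<forall>b\<in>B - h K. k y b \<in> V)"
    if "bd K" for K
    by metis
  have "K' \<inter> A \<subseteq> h K \<or> K \<inter> B \<subseteq> h K'" if K: "bd K" "bd K'" for K K'
  proof (rule ccontr)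
    assume "\<not> ?thesis"
    then obtain a b where "a \<in> K'" "a \<in> A - h K" "b \<in> K" "b \<in> B - h K'" by auto
    then have "k a b \<in> U" "k a b \<in> V" using h(2)[OF K(1)] h(2)[OF K(2)] by auto
    then show False using UV(3) by auto
  qed
  then show thesis using that[of h] h(1) by simp
qed

lemma linear_base_if_axes_disjoint:
  assumes D: "min_cofinal (bornology X Ent) D" and "normal_ballean Y F"
    and "asym_disjoint Y F ((\<lambda>a. k a p) ` X) (k p ` X)"
  shows "linearly_ordered_base X Ent"
proof -
  obtain h where h: "\<forall>K. bd K \<longrightarrow> bd (h K)"
    "\<forall>K K'. bd K \<longrightarrow> bd K' \<longrightarrow> K' \<inter> X \<subseteq> h K \<or> K \<inter> X \<subseteq> h K'"
    using normal_dichotomy[OF assms(2) _ _ assms(3)] by blast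
  show ?thesis
  proof (rule linear_base_if_dichotomy[OF D, of h])
    fix K K' assume K: "bd K" "bd K'"
    then have "K' \<inter> X = K'" "K \<inter> X = K" using bd_sub_carrier by auto
    then show "K' \<subseteq> h K \<or> K \<subseteq> h K'" using h(2) K by metis
  qed (use h(1) in simp)
qed

text \<open>The embedding of \<open>x\<close> as \<open>k x p\<close> preserves asymptotic
  disjointness, and neighborhoods pull back because \<open>x\<close> belongs to the support of its
  image.\<close>

lemma normal_base:
  assumes "normal_ballean Y F" shows "normal_ballean X Ent"
  unfolding normal_ballean_def
proof (intro allI impI)
  fix A B assume AB: "A \<subseteq> X \<and> B \<subseteq> X \<and> asym_disjoint X Ent A B"
  let ?j = "\<lambda>x. k x p"
  have j: "?j x \<in> Y" "x \<in> supp (?j x)" "supp (?j x) \<subseteq> {x, p}" if "x \<in> X" for x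
    using k_in[OF that base_point] k_supp[OF that base_point] by auto
  have "asym_disjoint Y F (?j ` A) (?j ` B)"
  proof (rule supp_asym_disjoint)
    show "asym_disjoint X Ent A B" using AB by simp
    show "x \<in> supp (?j x) \<and> supp (?j x) \<subseteq> {x, p}" if "x \<in> A" for x
      using j(2,3)[of x] AB that by blast
    show "x \<in> supp (?j x) \<and> supp (?j x) \<subseteq> {x, p}" if "x \<in> B" for x
      using j(2,3)[of x] AB that by blast
  qed
  moreover have "?j ` A \<subseteq> Y" "?j ` B \<subseteq> Y" using AB j(1) by auto
  ultimately obtain U V where UV: "asym_nbhd Y F U (?j ` A)" "asym_nbhd Y F V (?j ` B)" "U \<inter> V = {}"
    using assms unfolding normal_ballean_def by metis
  have nbhd: "asym_nbhd X Ent {x\<in>X. ?j x \<in> U} A" if "asym_nbhd Y F U (?j ` A)" for U A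
    unfolding asym_nbhd_def
  proof
    fix e assume "e \<in> Ent"
    then obtain d where e: "e \<in> Ent" and d: "d \<in> Ent"
      "\<And>x y. (x, y) \<in> e \<Longrightarrow> (x, y) \<in> d \<and> (y, x) \<in> d"
      using ent_sym by blast
    have "e `` A - {x\<in>X. ?j x \<in> U} \<subseteq> \<Union>(supp ` (hat d `` ?j ` A - U))"
    proof
      fix x assume "x \<in> e `` A - {x\<in>X. ?j x \<in> U}"
      then obtain a where a: "a \<in> A" "(a, x) \<in> e" "x \<in> X" "?j x \<notin> U"
        using ent_sub[OF e] by blast
      have "(?j a, ?j x) \<in> hat d"
        using k_hat[OF d(1)] d(2)[OF a(2)] ent_refl[OF d(1) base_point] by simp
      then have "?j x \<in> hat d `` ?j ` A - U" using a by auto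
      then show "x \<in> \<Union>(supp ` (hat d `` ?j ` A - U))" using j(2)[OF a(3)] by blast
    qed
    then show "bd (e `` A - {x\<in>X. ?j x \<in> U})" by (rule bd_subset[OF asym_nbhdD[OF that d(1)]])
  qed
  show "\<exists>U V. U \<subseteq> X \<and> V \<subseteq> X \<and> asym_nbhd X Ent U A \<and> asym_nbhd X Ent V B \<and> U \<inter> V = {}"
    by (rule exI[of _ "{x\<in>X. ?j x \<in> U}"], rule exI[of _ "{x\<in>X. ?j x \<in> V}"])
      (use nbhd[OF UV(1)] nbhd[OF UV(2)] UV(3) in auto)
qed

lemma linear_base_if_not_ultranormal:
  assumes D: "min_cofinal (bornology X Ent) D" and Y: "normal_ballean Y F"
    and "\<not> ultranormal X Ent"
  shows "linearly_ordered_base X Ent"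
proof -
  obtain A B where A: "A \<subseteq> X" "\<not> bd A" and B: "B \<subseteq> X" "\<not> bd B" and AB: "asym_disjoint X Ent A B"
    using assms(3) unfolding ultranormal_def by blast
  obtain U V where U: "asym_nbhd X Ent U A" and V: "asym_nbhd X Ent V B" and UV: "U \<inter> V = {}"
    using normal_base[OF Y] A(1) B(1) AB unfolding normal_ballean_def by metis
  have dich: "\<exists>h. (\<forall>K. bd K \<longrightarrow> bd (h K)) \<and>
      (\<forall>K K'. bd K \<longrightarrow> bd K' \<longrightarrow> K' \<inter> S \<subseteq> h K \<or> K \<inter> T \<subseteq> h K')"
    if ST: "S \<subseteq> X" "T \<subseteq> X" "asym_disjoint X Ent S T" for S T
  proof -
    have "asym_disjoint Y F ((\<lambda>a. k a p) ` S) (k p ` T)"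
    proof (rule supp_asym_disjoint[OF ST(3)])
      show "x \<in> supp (k x p) \<and> supp (k x p) \<subseteq> {x, p}" if "x \<in> S" for x
        using k_supp[of x p] base_point ST(1) that by blast
      show "x \<in> supp (k p x) \<and> supp (k p x) \<subseteq> {x, p}" if "x \<in> T" for x
        using k_supp[of p x] base_point ST(2) that by blast
    qed
    then obtain h where "\<forall>K. bd K \<longrightarrow> bd (h K)"
      "\<forall>K K'. bd K \<longrightarrow> bd K' \<longrightarrow> K' \<inter> S \<subseteq> h K \<or> K \<inter> T \<subseteq> h K'"
      by (rule normal_dichotomy[OF Y ST(1,2)])
    then show ?thesis by (intro exI[of _ h] conjI)
  qed
  obtain h1 where h1: "\<forall>K. bd K \<longrightarrow> bd (h1 K)"
      "\<forall>K K'. bd K \<longrightarrow> bd K' \<longrightarrow> K' \<inter> A \<subseteq> h1 K \<or> K \<inter> (X - U) \<subseteq> h1 K'"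
    using dich[OF A(1) Diff_subset asym_disjoint_Diff[OF U]] by (elim exE conjE)
  obtain h2 where h2: "\<forall>K. bd K \<longrightarrow> bd (h2 K)"
      "\<forall>K K'. bd K \<longrightarrow> bd K' \<longrightarrow> K' \<inter> B \<subseteq> h2 K \<or> K \<inter> (X - V) \<subseteq> h2 K'"
    using dich[OF B(1) Diff_subset asym_disjoint_Diff[OF V]] by (elim exE conjE)
  obtain h3 where h3: "\<forall>K. bd K \<longrightarrow> bd (h3 K)"
      "\<forall>K K'. bd K \<longrightarrow> bd K' \<longrightarrow> K' \<inter> A \<subseteq> h3 K \<or> K \<inter> B \<subseteq> h3 K'"
    using dich[OF A(1) B(1) AB] by (elim exE conjE)
  show ?thesis
  \<comment> \<open>Each dichotomy survives enlarging its function, so the union of the three serves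
    for all.\<close>
  proof (rule linear_base_if_cover[OF D _ _ A B, of "\<lambda>K. h1 K \<union> h2 K \<union> h3 K" "X - U" "X - V"])
    show "X \<subseteq> X - U \<union> (X - V)" using UV by auto
    fix K K' assume K: "bd K" "bd K'"
    show "bd (h1 K \<union> h2 K \<union> h3 K)" using h1(1) h2(1) h3(1) K by (intro bd_Un) simp_all
    show "K' \<inter> A \<subseteq> h1 K \<union> h2 K \<union> h3 K \<or> K \<inter> (X - U) \<subseteq> h1 K' \<union> h2 K' \<union> h3 K'"
      using h1(2)[rule_format, OF K] by auto
    show "K' \<inter> B \<subseteq> h1 K \<union> h2 K \<union> h3 K \<or> K \<inter> (X - V) \<subseteq> h1 K' \<union> h2 K' \<union> h3 K'"
      using h2(2)[rule_format, OF K] by auto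
    show "K' \<inter> A \<subseteq> h1 K \<union> h2 K \<union> h3 K \<or> K \<inter> B \<subseteq> h1 K' \<union> h2 K' \<union> h3 K'"
      using h3(2)[rule_format, OF K] by auto
  qed
qed

end

section \<open>Powers, symmetric powers and hyperballeans\<close>

text \<open>One \<open>e\<close> for all coordinates: such entourages are cofinal because finitely
  many entourages have a common bound, and they are indexed by entourages of
  \<open>X\<close>.\<close>

definition power_hat :: "'a set \<Rightarrow> nat \<Rightarrow> ('a \<times> 'a) set \<Rightarrow> ((nat \<Rightarrow> 'a) \<times> (nat \<Rightarrow> 'a)) set" where
  "power_hat X n e =
     {(x, y). x \<in> power_pts X n \<and> y \<in> power_pts X n \<and> (\<forall>i<n. (x i, y i) \<in> e)}"

definition symp_hat :: "'a set \<Rightarrow> nat \<Rightarrow> (nat \<Rightarrow> nat) set \<Rightarrow> ('a \<times> 'a) set \<Rightarrow>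
    ((nat \<Rightarrow> 'a) set \<times> (nat \<Rightarrow> 'a) set) set" where
  "symp_hat X n G e = (\<lambda>(x, y). (orbit_G G x, orbit_G G y)) ` power_hat X n e"

definition hyper_hat :: "'a set \<Rightarrow> ('a \<times> 'a) set set \<Rightarrow> ('a \<times> 'a) set \<Rightarrow> ('a set \<times> 'a set) set" where
  "hyper_hat X Ent e = {(A, B). A \<in> hyper_pts X Ent \<and> B \<in> hyper_pts X Ent \<and> A \<subseteq> e `` B \<and> B \<subseteq> e `` A}"

definition hyper_le_hat :: "'a set \<Rightarrow> ('a \<times> 'a) set set \<Rightarrow> nat \<Rightarrow> ('a \<times> 'a) set \<Rightarrow>
    ('a set \<times> 'a set) set" where
  "hyper_le_hat X Ent n e = hyper_hat X Ent e \<inter> (hyper_le_pts X Ent n \<times> hyper_le_pts X Ent n)"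

text \<open>\<open>s = id\<close> yields \<open>(x, y, p, p, \<dots>)\<close>; by truncated subtraction \<open>s = (\<lambda>i. i - 1)\<close> yields
  \<open>(x, x, y, p, p, \<dots>)\<close>.\<close>

definition tuple :: "nat \<Rightarrow> (nat \<Rightarrow> nat) \<Rightarrow> 'a \<Rightarrow> 'a \<Rightarrow> 'a \<Rightarrow> nat \<Rightarrow> 'a" where
  "tuple n s p x y = (\<lambda>i\<in>{..<n}. if s i = 0 then x else if s i = 1 then y else p)"

section \<open>Tuples and their orbits\<close>

lemma power_pts_in: "x \<in> power_pts X n \<Longrightarrow> i < n \<Longrightarrow> x i \<in> X"
  unfolding power_pts_def by auto

lemma tuple_in: "p \<in> X \<Longrightarrow> x \<in> X \<Longrightarrow> y \<in> X \<Longrightarrow> tuple n s p x y \<in> power_pts X n"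
  unfolding power_pts_def tuple_def by auto

lemma orbit_eqD:
  assumes "perm_subgroup n G" "orbit_G G x = orbit_G G y" shows "\<exists>g\<in>G. x = y \<circ> g"
proof -
  have "id \<in> G" using assms(1) unfolding perm_subgroup_def by blast
  then have "x \<in> orbit_G G x" unfolding orbit_G_def by (intro image_eqI[of _ _ id]) simp_all
  then show ?thesis using assms(2) unfolding orbit_G_def by auto
qed

lemma orbit_comp_inv:
  assumes G: "perm_subgroup n G" and g: "g \<in> G" shows "orbit_G G (x \<circ> inv g) = orbit_G G x"
proof -
  have gp: "g permutes {..<n}" and ig: "inv g \<in> G" using G g unfolding perm_subgroup_def by blast+
  have "(x \<circ> inv g) \<circ> h \<in> orbit_G G x" if "h \<in> G" for h
    using G ig that unfolding perm_subgroup_def orbit_G_def by (auto simp: comp_assoc)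
  moreover have "x \<circ> h \<in> orbit_G G (x \<circ> inv g)" if "h \<in> G" for h
  proof -
    have "x \<circ> h = (x \<circ> inv g) \<circ> (g \<circ> h)"
      using permutes_inv_o(2)[OF gp] by (simp add: comp_assoc[symmetric]) (simp add: comp_assoc)
    moreover have "g \<circ> h \<in> G" using G g that unfolding perm_subgroup_def by auto
    ultimately show ?thesis unfolding orbit_G_def by (rule image_eqI)
  qed
  ultimately show ?thesis unfolding orbit_G_def[of G "x \<circ> inv g"] orbit_G_def[of G x]
    by (auto simp: orbit_G_def)
qed

lemma power_pts_comp:
  assumes "g permutes {..<n}" "x \<in> power_pts X n" shows "x \<circ> g \<in> power_pts X n"
  using assms permutes_in_image[OF assms(1)] permutes_not_in[OF assms(1)]
  unfolding power_pts_def PiE_iff extensional_def by auto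

text \<open>The given pair comes from some representative \<open>u = x \<circ> g\<close>; shifting
  its partner by \<open>inv g\<close> realigns it with the prescribed \<open>x\<close>.\<close>

lemma symp_hat_orbit:
  assumes G: "perm_subgroup n G" and "(orbit_G G x, z) \<in> symp_hat X n G e"
  shows "\<exists>y. z = orbit_G G y \<and> y \<in> power_pts X n \<and> (\<forall>i<n. (x i, y i) \<in> e)"
proof -
  obtain u w where uw: "orbit_G G u = orbit_G G x" "z = orbit_G G w" "(u, w) \<in> power_hat X n e"
    using assms(2) unfolding symp_hat_def by auto
  obtain g where g: "g \<in> G" "u = x \<circ> g" using orbit_eqD[OF G uw(1)] by blast
  have gp: "g permutes {..<n}" using G g(1) unfolding perm_subgroup_def by blast
  have ip: "inv g permutes {..<n}" by (rule permutes_inv[OF gp])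
  have "(x i, (w \<circ> inv g) i) \<in> e" if "i < n" for i
  proof -
    have "inv g i < n" using permutes_in_image[OF ip, of i] that by simp
    then have "(u (inv g i), w (inv g i)) \<in> e" using uw(3) unfolding power_hat_def by blast
    then show ?thesis using g(2) permutes_inverses(1)[OF gp] by simp
  qed
  moreover have "w \<circ> inv g \<in> power_pts X n"
    using power_pts_comp[OF ip] uw(3) unfolding power_hat_def by blast
  ultimately show ?thesis using orbit_comp_inv[OF G g(1), of w] uw(2)
    by (intro exI[of _ "w \<circ> inv g"]) simp
qed

lemma orbit_support:
  assumes "perm_subgroup n G" shows "(\<Union>y\<in>orbit_G G x. y ` {..<n}) = x ` {..<n}"
proof -
  have "(x \<circ> g) ` {..<n} = x ` {..<n}" if "g \<in> G" for g
  proof -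
    have "g ` {..<n} = {..<n}" using assms that permutes_image unfolding perm_subgroup_def by blast
    then show ?thesis using image_comp[of x g "{..<n}"] by metis
  qed
  moreover have "id \<in> G" using assms unfolding perm_subgroup_def by blast
  ultimately show ?thesis unfolding orbit_G_def by auto
qed

context pointed_ballean
begin

lemma ent_finite_bound:
  fixes n :: nat
  assumes "\<forall>i<n. Es i \<in> Ent" shows "\<exists>e\<in>Ent. \<forall>i<n. Es i \<subseteq> e"
  using assms
proof (induction n)
  case 0
  then show ?case using ent_nonempty by blast
next
  case (Suc n)
  then obtain e where e: "e \<in> Ent" "\<forall>i<n. Es i \<subseteq> e" by auto
  have "Es n \<in> Ent" using Suc.prems by simp
  then obtain d where "d \<in> Ent" "e \<subseteq> d" "Es n \<subseteq> d" by (rule ent_union[OF e(1)])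
  then show ?case using e(2) by (intro bexI[of _ d]) (auto simp: less_Suc_eq)
qed

lemma power_hat_in: "e \<in> Ent \<Longrightarrow> power_hat X n e \<in> power_ent X Ent n"
  unfolding power_hat_def power_ent_def by (intro CollectI exI[of _ "\<lambda>_. e"]) simp

lemma power_hat_cofinal:
  assumes "f \<in> power_ent X Ent n" shows "\<exists>e\<in>Ent. f \<subseteq> power_hat X n e"
proof -
  obtain Es where Es: "\<forall>i<n. Es i \<in> Ent" and f: "f =
    {(x, y). x \<in> power_pts X n \<and> y \<in> power_pts X n \<and> (\<forall>i<n. (x i, y i) \<in> Es i)}"
    using assms unfolding power_ent_def by blast
  obtain e where e: "e \<in> Ent" "\<forall>i<n. Es i \<subseteq> e" using ent_finite_bound[OF Es] by blast
  have "f \<subseteq> power_hat X n e" unfolding f power_hat_def using e(2) by auto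
  then show ?thesis using e(1) by blast
qed

lemma power_hat_mono: "e \<subseteq> d \<Longrightarrow> power_hat X n e \<subseteq> power_hat X n d"
  unfolding power_hat_def by auto

lemma power_hat_supp:
  assumes "(x, y) \<in> power_hat X n e"
  shows "x ` {..<n} \<subseteq> (e \<union> e\<inverse>) `` y ` {..<n}" "y ` {..<n} \<subseteq> (e \<union> e\<inverse>) `` x ` {..<n}"
  using assms unfolding power_hat_def by auto

lemma power_centre:
  assumes "x \<in> power_pts X n" "\<forall>z\<in>x ` {..<n}. (p, z) \<in> e \<and> (z, p) \<in> e"
  shows "(tuple n s p p p, x) \<in> power_hat X n e"
  using assms tuple_in[OF base_point base_point base_point, of n s]
  unfolding power_hat_def by (auto simp: tuple_def)

lemma power_supp_bounded: "x \<in> power_pts X n \<Longrightarrow> bd (x ` {..<n})"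
  by (rule bd_finite) (auto simp: power_pts_in)

lemma tuple_hat:
  assumes "e \<in> Ent" "{(x, x'), (x', x), (y, y'), (y', y)} \<subseteq> e"
  shows "(tuple n s p x y, tuple n s p x' y') \<in> power_hat X n e"
  using assms(2) ent_refl[OF assms(1) base_point] ent_sub[OF assms(1), of x x']
    ent_sub[OF assms(1), of y y'] tuple_in[OF base_point]
  unfolding power_hat_def by (auto simp: tuple_def)

lemma tuple_supp:
  assumes "i < n" "s i = 0" "j < n" "s j = 1"
  shows "{x, y} \<subseteq> tuple n s p x y ` {..<n} \<and> tuple n s p x y ` {..<n} \<subseteq> {x, y, p}"
proof -
  have "tuple n s p x y i = x" "tuple n s p x y j = y" using assms by (simp_all add: tuple_def)
  then have "{x, y} \<subseteq> tuple n s p x y ` {..<n}" using assms(1,3) by force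
  then show ?thesis by (auto simp: tuple_def)
qed

section \<open>Powers and symmetric powers as derived balleans\<close>

lemma power_derived:
  "derived_ballean X Ent p (power_pts X n) (power_ent X Ent n) (\<lambda>x. x ` {..<n}) (power_hat X n)
     (tuple n id p p p)"
proof
  show "y \<in> power_pts X n \<and> z \<in> power_pts X n \<and> y ` {..<n} \<subseteq> (e \<union> e\<inverse>) `` z ` {..<n} \<and>
      z ` {..<n} \<subseteq> (e \<union> e\<inverse>) `` y ` {..<n}" if "(y, z) \<in> power_hat X n e" for y z e
    using that power_hat_supp[OF that] unfolding power_hat_def by simp
qed (use power_hat_in power_hat_cofinal power_hat_mono power_supp_bounded power_centre
  tuple_in[OF base_point base_point base_point] in simp_all)

lemma power_probed:
  assumes "n \<ge> 2"
  shows "probed_ballean X Ent p (power_pts X n) (power_ent X Ent n) (\<lambda>x. x ` {..<n})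
     (power_hat X n) (tuple n id p p p) (tuple n id p)"
proof -
  interpret derived_ballean X Ent p "power_pts X n" "power_ent X Ent n" "\<lambda>x. x ` {..<n}"
    "power_hat X n" "tuple n id p p p" by (rule power_derived)
  show ?thesis
  proof
    show "(tuple n id p x y, tuple n id p x' y') \<in> power_hat X n e"
      if "e \<in> Ent" "{(x, x'), (x', x), (y, y'), (y', y)} \<subseteq> e" for e x x' y y'
      by (rule tuple_hat[OF that])
  qed (use tuple_supp[of 0 n id 1] assms in simp)
qed

lemma symp_derived:
  assumes G: "perm_subgroup n G"
  shows "derived_ballean X Ent p (symp_pts X n G) (symp_ent X Ent n G) (\<lambda>o'. \<Union>x\<in>o'. x ` {..<n})
     (symp_hat X n G) (orbit_G G (tuple n id p p p))"
proof
  let ?supp = "\<lambda>o'. \<Union>x\<in>o'. x ` {..<n}"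
  show "symp_hat X n G e \<in> symp_ent X Ent n G" if "e \<in> Ent" for e
    unfolding symp_hat_def symp_ent_def by (rule imageI) (rule power_hat_in[OF that])
  show "\<exists>e\<in>Ent. f \<subseteq> symp_hat X n G e" if f: "f \<in> symp_ent X Ent n G" for f
  proof -
    obtain f' where f': "f' \<in> power_ent X Ent n" "f = (\<lambda>(x, y). (orbit_G G x, orbit_G G y)) ` f'"
      using f unfolding symp_ent_def by blast
    obtain e where "e \<in> Ent" "f' \<subseteq> power_hat X n e" using power_hat_cofinal[OF f'(1)] by blast
    then show ?thesis unfolding f'(2) symp_hat_def by (intro bexI[of _ e] image_mono)
  qed
  show "symp_hat X n G e \<subseteq> symp_hat X n G d" if "e \<subseteq> d" for e d
    unfolding symp_hat_def by (intro image_mono power_hat_mono that)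
  show "y \<in> symp_pts X n G \<and> z \<in> symp_pts X n G \<and>
      ?supp y \<subseteq> (e \<union> e\<inverse>) `` ?supp z \<and> ?supp z \<subseteq> (e \<union> e\<inverse>) `` ?supp y"
    if yz: "(y, z) \<in> symp_hat X n G e" for y z e
  proof -
    obtain u w where u: "y = orbit_G G u" "z = orbit_G G w" "(u, w) \<in> power_hat X n e"
      using yz unfolding symp_hat_def by auto
    show ?thesis
      using u(3) power_hat_supp[OF u(3)]
      unfolding u(1,2) orbit_support[OF G] symp_pts_def power_hat_def by simp
  qed
  show "bd (?supp y)" if "y \<in> symp_pts X n G" for y
    using that power_supp_bounded unfolding symp_pts_def by (auto simp: orbit_support[OF G])
  show "orbit_G G (tuple n id p p p) \<in> symp_pts X n G"
    unfolding symp_pts_def by (intro imageI tuple_in base_point)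
  show "(orbit_G G (tuple n id p p p), y) \<in> symp_hat X n G e"
    if "y \<in> symp_pts X n G" "\<forall>x\<in>?supp y. (p, x) \<in> e \<and> (x, p) \<in> e" for y e
  proof -
    obtain u where u: "y = orbit_G G u" "u \<in> power_pts X n"
      using \<open>y \<in> symp_pts X n G\<close> unfolding symp_pts_def by blast
    have "(tuple n id p p p, u) \<in> power_hat X n e"
      by (rule power_centre[OF u(2)]) (use that(2) in \<open>simp only: u(1) orbit_support[OF G]\<close>)
    then show ?thesis unfolding u(1) symp_hat_def by (rule rev_image_eqI) simp
  qed
qed

lemma symp_probed:
  assumes G: "perm_subgroup n G" and s: "i < n" "s i = 0" "j < n" "s j = 1"
  shows "probed_ballean X Ent p (symp_pts X n G) (symp_ent X Ent n G) (\<lambda>o'. \<Union>x\<in>o'. x ` {..<n})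
     (symp_hat X n G) (orbit_G G (tuple n id p p p)) (\<lambda>x y. orbit_G G (tuple n s p x y))"
proof -
  interpret derived_ballean X Ent p "symp_pts X n G" "symp_ent X Ent n G"
    "\<lambda>o'. \<Union>x\<in>o'. x ` {..<n}" "symp_hat X n G" "orbit_G G (tuple n id p p p)"
    by (rule symp_derived[OF G])
  show ?thesis
  proof
    show "(orbit_G G (tuple n s p x y), orbit_G G (tuple n s p x' y')) \<in> symp_hat X n G e"
      if "e \<in> Ent" "{(x, x'), (x', x), (y, y'), (y', y)} \<subseteq> e" for e x x' y y'
      unfolding symp_hat_def by (rule rev_image_eqI[OF tuple_hat[OF that]]) simp
  qed (use tuple_supp[OF s] in \<open>simp only: orbit_support[OF G] simp_thms\<close>)
qed

text \<open>At every coordinate one of the two tuples has entry \<open>p\<close>: the second at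
  \<open>0\<close>, the first elsewhere. A point close to both is therefore close to
  \<open>p\<close> throughout.\<close>

lemma power_axes_disjoint:
  assumes "n \<ge> 2"
  shows "asym_disjoint (power_pts X n) (power_ent X Ent n)
    ((\<lambda>a. tuple n id p a p) ` X) (tuple n id p p ` X)"
proof -
  interpret derived_ballean X Ent p "power_pts X n" "power_ent X Ent n" "\<lambda>x. x ` {..<n}"
    "power_hat X n" "tuple n id p p p" by (rule power_derived)
  show ?thesis
  proof (rule asym_disjointI)
    fix e assume e: "e \<in> Ent"
    have "z i \<in> e `` {p}"
      if a: "(tuple n id p a p, z) \<in> power_hat X n e" and b: "(tuple n id p p b, z) \<in> power_hat X n e"
        and i: "i < n" for z a b i
    proof -
      have "(tuple n id p a p i, z i) \<in> e" "(tuple n id p p b i, z i) \<in> e"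
        using a b i unfolding power_hat_def by auto
      then show ?thesis using i by (cases "i = 0") (simp_all add: tuple_def)
    qed
    then have "(\<Union>x\<in>power_hat X n e `` (\<lambda>a. tuple n id p a p) ` X \<inter>
        power_hat X n e `` tuple n id p p ` X. x ` {..<n}) \<subseteq> e `` {p}"
      by blast
    moreover have "bd (e `` {p})" using e base_point unfolding bounded_in_def by blast
    ultimately show "bd (\<Union>x\<in>power_hat X n e `` (\<lambda>a. tuple n id p a p) ` X \<inter>
        power_hat X n e `` tuple n id p p ` X. x ` {..<n})"
      by (rule bd_subset[rotated])
  qed
qed

text \<open>A permutation moves one of the two positions of \<open>a\<close> in \<open>(a, a, p, \<dots>)\<close> onto a \<open>p\<close> in
  \<open>(p, p, b, p, \<dots>)\<close>, so that \<open>a\<close> is close to \<open>p\<close>.\<close>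

lemma symp_axes_disjoint:
  assumes G: "perm_subgroup n G" and n: "n \<ge> 3"
  defines "k \<equiv> \<lambda>x y. orbit_G G (tuple n (\<lambda>i. i - 1) p x y)"
  shows "asym_disjoint (symp_pts X n G) (symp_ent X Ent n G) ((\<lambda>a. k a p) ` X) (k p ` X)"
proof -
  interpret derived_ballean X Ent p "symp_pts X n G" "symp_ent X Ent n G"
    "\<lambda>o'. \<Union>x\<in>o'. x ` {..<n}" "symp_hat X n G" "orbit_G G (tuple n id p p p)"
    by (rule symp_derived[OF G])
  let ?t = "tuple n (\<lambda>i. i - 1) p"
  show ?thesis
  proof (rule asym_disjointI)
    fix e assume e: "e \<in> Ent"
    \<comment> \<open>Two steps from \<open>p\<close> reach \<open>a\<close> by way of the
      coordinate \<open>u i\<close>.\<close>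
    define N where "N = {p} \<union> (e \<union> e\<inverse>) `` ((e \<union> e\<inverse>) `` {p})"
    have "bd ((e \<union> e\<inverse>) `` N)"
      unfolding N_def by (intro bd_Image[OF e] bd_Un bd_singleton base_point)
    moreover have "(\<Union>x\<in>z. x ` {..<n}) \<subseteq> (e \<union> e\<inverse>) `` N"
      if a: "(k a p, z) \<in> symp_hat X n G e" and b: "(k p b, z) \<in> symp_hat X n G e" for a b z
    proof -
      obtain u where u: "z = orbit_G G u" "\<forall>i<n. (?t a p i, u i) \<in> e"
        using symp_hat_orbit[OF G a[unfolded k_def]] by blast
      obtain w where w: "z = orbit_G G w" "\<forall>i<n. (?t p b i, w i) \<in> e"
        using symp_hat_orbit[OF G b[unfolded k_def]] by blast
      obtain g where g: "g \<in> G" "u = w \<circ> g" using orbit_eqD[OF G, of u w] u(1) w(1) by auto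
      have gp: "g permutes {..<n}" using G g(1) unfolding perm_subgroup_def by blast
      \<comment> \<open>By injectivity at most one of the positions \<open>0\<close> and
        \<open>1\<close>, both holding \<open>a\<close>, is sent to position \<open>2\<close>, which
        holds \<open>b\<close>.\<close>
      have "g 0 \<noteq> g 1" using permutes_inj[OF gp] by (auto dest: injD)
      then obtain i :: nat where i: "i < 2" "g i \<noteq> 2"
        by (metis zero_less_numeral one_less_numeral_iff semiring_norm(76))
      have "g i < n" using permutes_in_image[OF gp, of i] i(1) n by simp
      then have "(?t p b (g i), w (g i)) \<in> e" using w(2) by blast
      moreover have "?t p b (g i) = p" using \<open>g i < n\<close> i(2) unfolding tuple_def by auto
      ultimately have "(p, u i) \<in> e" using g(2) by simp
      moreover have "(?t a p i, u i) \<in> e" using u(2) i(1) n by simp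
      moreover have "?t a p i = a" using i(1) n unfolding tuple_def by auto
      ultimately have "a \<in> N" unfolding N_def by auto
      moreover have "p \<in> N" unfolding N_def by simp
      ultimately have "?t a p j \<in> N" if "j < n" for j using that unfolding tuple_def by simp
      then show ?thesis unfolding u(1) orbit_support[OF G] using u(2) by blast
    qed
    ultimately show "bd (\<Union>z\<in>symp_hat X n G e `` (\<lambda>a. k a p) ` X \<inter> symp_hat X n G e `` k p ` X.
        \<Union>x\<in>z. x ` {..<n})"
      by (elim bd_subset) blast
  qed
qed

section \<open>Hyperballeans as derived balleans, each set being its own support\<close>

lemma hyper_pts_iff: "A \<in> hyper_pts X Ent \<longleftrightarrow> bd A \<and> A \<noteq> {}"
  unfolding hyper_pts_def bornology_def by simp

lemma hyper_ent_eq: "hyper_ent X Ent = hyper_hat X Ent ` Ent"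
  unfolding hyper_ent_def hyper_hat_def ..

lemma hyper_le_ent_eq: "hyper_le_ent X Ent n = hyper_le_hat X Ent n ` Ent"
  unfolding hyper_le_ent_def hyper_ent_eq image_image hyper_le_hat_def ..

lemma hyper_le_subset: "hyper_le_pts X Ent n \<subseteq> hyper_pts X Ent"
  unfolding hyper_le_pts_def by auto

lemma hyper_hat_mono: "e \<subseteq> d \<Longrightarrow> hyper_hat X Ent e \<subseteq> hyper_hat X Ent d"
  unfolding hyper_hat_def by blast

lemma hyper_hat_supp:
  assumes "(A, B) \<in> hyper_hat X Ent e"
  shows "A \<in> hyper_pts X Ent" "B \<in> hyper_pts X Ent"
    "A \<subseteq> (e \<union> e\<inverse>) `` B" "B \<subseteq> (e \<union> e\<inverse>) `` A"
  using assms unfolding hyper_hat_def by auto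

lemma hyper_centre:
  assumes "A \<in> hyper_pts X Ent" "\<forall>x\<in>A. (p, x) \<in> e \<and> (x, p) \<in> e"
  shows "({p}, A) \<in> hyper_hat X Ent e"
  using assms bd_singleton[OF base_point] unfolding hyper_hat_def hyper_pts_iff by auto

lemma hyper_le_singleton: "n \<ge> 1 \<Longrightarrow> {p} \<in> hyper_le_pts X Ent n"
  using bd_singleton[OF base_point] unfolding hyper_le_pts_def hyper_pts_iff by simp

lemma hyper_le_pair:
  assumes "n \<ge> 2" "x \<in> X" "y \<in> X" shows "{x, y} \<in> hyper_le_pts X Ent n"
proof -
  have "bd {x, y}" by (rule bd_finite) (use assms in auto)
  moreover have "card {x, y} \<le> 2" by (simp add: card_insert_if)
  ultimately show ?thesis using assms(1) unfolding hyper_le_pts_def hyper_pts_iff by simp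
qed

lemma hyper_hat_pair:
  assumes "e \<in> Ent" "{(x, x'), (x', x), (y, y'), (y', y)} \<subseteq> e"
  shows "({x, y}, {x', y'}) \<in> hyper_hat X Ent e"
proof -
  have X: "x \<in> X" "x' \<in> X" "y \<in> X" "y' \<in> X"
    using assms(2) ent_sub[OF assms(1), of x x'] ent_sub[OF assms(1), of y y'] by auto
  have "bd {x, y}" "bd {x', y'}" by (rule bd_finite; use X in simp)+
  then show ?thesis using assms(2) unfolding hyper_hat_def hyper_pts_iff by auto
qed

lemma hyper_derived:
  "derived_ballean X Ent p (hyper_pts X Ent) (hyper_ent X Ent) (\<lambda>A. A) (hyper_hat X Ent) {p}"
proof
  show "\<exists>e\<in>Ent. f \<subseteq> hyper_hat X Ent e" if "f \<in> hyper_ent X Ent" for f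
    using that unfolding hyper_ent_eq by blast
  show "y \<in> hyper_pts X Ent \<and> z \<in> hyper_pts X Ent \<and>
      y \<subseteq> (e \<union> e\<inverse>) `` z \<and> z \<subseteq> (e \<union> e\<inverse>) `` y" if "(y, z) \<in> hyper_hat X Ent e" for y z e
    using hyper_hat_supp[OF that] by simp
qed (use hyper_hat_mono hyper_centre bd_singleton[OF base_point]
  in \<open>simp_all add: hyper_ent_eq hyper_pts_iff\<close>)

lemma hyper_probed:
  "probed_ballean X Ent p (hyper_pts X Ent) (hyper_ent X Ent) (\<lambda>A. A) (hyper_hat X Ent) {p}
     (\<lambda>x y. {x, y})"
proof -
  interpret derived_ballean X Ent p "hyper_pts X Ent" "hyper_ent X Ent" "\<lambda>A. A" "hyper_hat X Ent"
    "{p}" by (rule hyper_derived)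
  show ?thesis
  proof
    show "({x, y}, {x', y'}) \<in> hyper_hat X Ent e"
      if "e \<in> Ent" "{(x, x'), (x', x), (y, y'), (y', y)} \<subseteq> e" for e x x' y y'
      by (rule hyper_hat_pair[OF that])
  qed auto
qed

lemma hyper_le_derived:
  assumes "n \<ge> 1"
  shows "derived_ballean X Ent p (hyper_le_pts X Ent n) (hyper_le_ent X Ent n) (\<lambda>A. A)
    (hyper_le_hat X Ent n) {p}"
proof
  show "\<exists>e\<in>Ent. f \<subseteq> hyper_le_hat X Ent n e" if "f \<in> hyper_le_ent X Ent n" for f
    using that unfolding hyper_le_ent_eq by blast
  show "hyper_le_hat X Ent n e \<subseteq> hyper_le_hat X Ent n d" if "e \<subseteq> d" for e d
    using hyper_hat_mono[OF that] unfolding hyper_le_hat_def by blast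
  show "y \<in> hyper_le_pts X Ent n \<and> z \<in> hyper_le_pts X Ent n \<and>
      y \<subseteq> (e \<union> e\<inverse>) `` z \<and> z \<subseteq> (e \<union> e\<inverse>) `` y" if "(y, z) \<in> hyper_le_hat X Ent n e" for y z e
    using that hyper_hat_supp[of y z e] unfolding hyper_le_hat_def by blast
  show "bd y" if "y \<in> hyper_le_pts X Ent n" for y
    using that unfolding hyper_le_pts_def hyper_pts_iff by blast
  show "({p}, y) \<in> hyper_le_hat X Ent n e"
    if "y \<in> hyper_le_pts X Ent n" "\<forall>x\<in>y. (p, x) \<in> e \<and> (x, p) \<in> e" for y e
    using hyper_centre[of y e] that hyper_le_subset hyper_le_singleton[OF assms]
    unfolding hyper_le_hat_def by blast
qed (use hyper_le_singleton[OF assms] in \<open>simp_all add: hyper_le_ent_eq\<close>)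

lemma hyper_le_probed:
  assumes n: "n \<ge> 2"
  shows "probed_ballean X Ent p (hyper_le_pts X Ent n) (hyper_le_ent X Ent n) (\<lambda>A. A)
    (hyper_le_hat X Ent n) {p} (\<lambda>x y. {x, y})"
proof -
  interpret derived_ballean X Ent p "hyper_le_pts X Ent n" "hyper_le_ent X Ent n" "\<lambda>A. A"
    "hyper_le_hat X Ent n" "{p}" by (rule hyper_le_derived) (use n in simp)
  show ?thesis
  proof
    show "({x, y}, {x', y'}) \<in> hyper_le_hat X Ent n e"
      if e: "e \<in> Ent" "{(x, x'), (x', x), (y, y'), (y', y)} \<subseteq> e" for e x x' y y'
    proof -
      have "x \<in> X" "x' \<in> X" "y \<in> X" "y' \<in> X"
        using e(2) ent_sub[OF e(1), of x x'] ent_sub[OF e(1), of y y'] by auto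
      then show ?thesis
        using hyper_hat_pair[OF e] hyper_le_pair[OF n] unfolding hyper_le_hat_def by simp
    qed
  qed auto
qed

end

section \<open>Degenerate case and the equivalences\<close>

lemma normal_ballean_no_entourages: "normal_ballean Y {}"
  \<comment> \<open>Every set is vacuously an asymptotic neighborhood, so \<open>{}\<close> serves
    as \<open>U\<close> and as \<open>V\<close>.\<close>
  unfolding normal_ballean_def asym_nbhd_def by blast

text \<open>Over the empty set not even \<open>{}\<close> is bounded.\<close>

lemma cof_regular_empty:
  assumes "ballean {} Ent" "cof_regular {} Ent" shows "Ent = {}"
proof -
  obtain C D where C: "min_cofinal Ent C" and D: "min_cofinal (bornology {} Ent) D" and "C \<approx> D"
    using assms(2) unfolding cof_regular_def by blast
  have "bornology {} Ent = {}" unfolding bornology_def bounded_in_def by simp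
  then have "D = {}" using D unfolding min_cofinal_def cofinal_in_def by simp
  then have "C = {}" using \<open>C \<approx> D\<close> by simp
  then show ?thesis using C unfolding min_cofinal_def cofinal_in_def by blast
qed

lemma perm_subgroup_id: "perm_subgroup n {id}"
  unfolding perm_subgroup_def by (simp add: permutes_id)

lemma perm_subgroup_symmetric: "perm_subgroup n {g. g permutes {..<n}}"
  unfolding perm_subgroup_def by (simp add: permutes_id permutes_compose permutes_inv)

theorem theorem1p15:
  fixes X :: "'a set" and Ent :: "('a \<times> 'a) set set"
  assumes "ballean X Ent" and "cof_regular X Ent"
  defines "P1 \<equiv> (\<forall>n\<ge>1. \<forall>G. perm_subgroup n G \<longrightarrow> normal_ballean (symp_pts X n G) (symp_ent X Ent n G))"
      and "P2 \<equiv> (\<exists>n\<ge>3. \<exists>G. perm_subgroup n G \<and> normal_ballean (symp_pts X n G) (symp_ent X Ent n G))"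
      and "P3 \<equiv> (\<forall>n\<ge>1. normal_ballean (power_pts X n) (power_ent X Ent n))"
      and "P4 \<equiv> (\<exists>n\<ge>2. normal_ballean (power_pts X n) (power_ent X Ent n))"
      and "P5 \<equiv> linearly_ordered_base X Ent"
      and "P6 \<equiv> (\<exists>n\<ge>2. \<exists>G. perm_subgroup n G \<and> normal_ballean (symp_pts X n G) (symp_ent X Ent n G))"
      and "P7 \<equiv> normal_ballean (symp_pts X 2 {g. g permutes {..<2}}) (symp_ent X Ent 2 {g. g permutes {..<2}})"
      and "P8 \<equiv> normal_ballean (hyper_le_pts X Ent 2) (hyper_le_ent X Ent 2)"
      and "P9 \<equiv> (\<exists>n\<ge>2. normal_ballean (hyper_le_pts X Ent n) (hyper_le_ent X Ent n))"
      and "P10 \<equiv> (\<forall>n\<ge>1. normal_ballean (hyper_le_pts X Ent n) (hyper_le_ent X Ent n))"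
      and "P11 \<equiv> normal_ballean (hyper_pts X Ent) (hyper_ent X Ent)"
  shows "(P1 \<longleftrightarrow> P2) \<and> (P1 \<longleftrightarrow> P3) \<and> (P1 \<longleftrightarrow> P4) \<and> (P1 \<longleftrightarrow> P5) \<and>
         (\<not> ultranormal X Ent \<longrightarrow>
            (P1 \<longleftrightarrow> P6) \<and> (P1 \<longleftrightarrow> P7) \<and> (P1 \<longleftrightarrow> P8) \<and> (P1 \<longleftrightarrow> P9) \<and>
            (P1 \<longleftrightarrow> P10) \<and> (P1 \<longleftrightarrow> P11))"
proof (cases "X = {}")
  case True
  have "Ent = {}" using cof_regular_empty assms(1,2) unfolding True by blast
  \<comment> \<open>For \<open>n = 0\<close> the choice of the \<open>Es i\<close> is vacuous and
    one entourage would remain.\<close>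
  have pow: "power_ent X Ent n = {}" if "n \<ge> 1" for n
    using that unfolding power_ent_def \<open>Ent = {}\<close> by (auto dest: spec[of _ 0])
  then have symp: "symp_ent X Ent n G = {}" if "n \<ge> 1" for n G
    using that unfolding symp_ent_def by simp
  have hyper: "hyper_ent X Ent = {}" "hyper_le_ent X Ent n = {}" for n
    unfolding hyper_le_ent_def hyper_ent_def \<open>Ent = {}\<close> by simp_all
  have P3 unfolding P3_def by (simp add: pow normal_ballean_no_entourages)
  moreover have P4
    unfolding P4_def by (intro exI[of _ 2]) (simp add: pow normal_ballean_no_entourages)
  moreover have P1 unfolding P1_def by (simp add: symp normal_ballean_no_entourages)
  moreover have P2
    unfolding P2_def by (intro exI[of _ 3] conjI exI[of _ "{id}"])
      (simp_all add: perm_subgroup_id symp normal_ballean_no_entourages)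
  moreover have P6
    unfolding P6_def by (intro exI[of _ 2] conjI exI[of _ "{id}"])
      (simp_all add: perm_subgroup_id symp normal_ballean_no_entourages)
  moreover have P5
    unfolding P5_def linearly_ordered_base_def bornology_def bounded_in_def \<open>Ent = {}\<close> by simp
  moreover have P7 unfolding P7_def by (simp add: symp normal_ballean_no_entourages)
  moreover have P8 P10 P11
    unfolding P8_def P10_def P11_def by (simp_all add: hyper normal_ballean_no_entourages)
  moreover have P9
    unfolding P9_def by (intro exI[of _ 2]) (simp add: hyper normal_ballean_no_entourages)
  ultimately show ?thesis by simp
next
  case False
  then obtain p where "p \<in> X" by blast
  then interpret pointed_ballean X Ent p using assms(1) by unfold_locales
  obtain C D where C: "min_cofinal Ent C" and D: "min_cofinal (bornology X Ent) D" and CD: "C \<approx> D"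
    using assms(2) unfolding cof_regular_def by blast
  note normalI = derived_ballean.normal_if_linear_base[OF _ D C CD]
    and axes = probed_ballean.linear_base_if_axes_disjoint[OF _ D]
    and nonultra = probed_ballean.linear_base_if_not_ultranormal[OF _ D]
  \<comment> \<open>Labels name implications: \<open>51\<close> leads from \<open>P5\<close> to
    \<open>P1\<close>. Returns to \<open>P5\<close> start at \<open>P2\<close> and
    \<open>P4\<close>, and, without ultranormality, at \<open>P6\<close>, \<open>P9\<close> and
    \<open>P11\<close>.\<close>
  have 51: P1 if P5
    unfolding P1_def using that unfolding P5_def by (intro allI impI normalI[OF symp_derived])
  have 53: P3 if P5
    unfolding P3_def using that unfolding P5_def by (intro allI impI normalI[OF power_derived])
  have 510: P10 if P5
    unfolding P10_def using that unfolding P5_def by (intro allI impI normalI[OF hyper_le_derived])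
  have 511: P11 if P5
    unfolding P11_def using that unfolding P5_def by (intro allI impI normalI[OF hyper_derived])
  have 12: P2 if P1
  proof -
    have "normal_ballean (symp_pts X 3 {id}) (symp_ent X Ent 3 {id})"
      by (rule that[unfolded P1_def, rule_format]) (simp_all add: perm_subgroup_id)
    then show ?thesis
      unfolding P2_def
      by (intro exI[of _ "3 :: nat"] exI[of _ "{id}"] conjI order_refl perm_subgroup_id)
  qed
  have 17: P7 if P1
    unfolding P7_def
    by (rule that[unfolded P1_def, rule_format]) (simp_all add: perm_subgroup_symmetric)
  have 34: P4 if P3
    unfolding P4_def
    by (intro exI[of _ "2 :: nat"] conjI order_refl that[unfolded P3_def, rule_format]) simp
  have 76: P6 if P7
    using that unfolding P6_def P7_def
    by (intro exI[of _ "2 :: nat"] exI[of _ "{g. g permutes {..<2}}"] conjI order_refl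
        perm_subgroup_symmetric)
  have 108: P8 if P10
    unfolding P8_def by (rule that[unfolded P10_def, rule_format]) simp
  have 89: P9 if P8
    using that unfolding P8_def P9_def by (intro exI[of _ "2 :: nat"] conjI order_refl)
  have 45: P5 if P4
  proof -
    obtain n where n: "n \<ge> 2" and "normal_ballean (power_pts X n) (power_ent X Ent n)"
      using \<open>P4\<close> unfolding P4_def by blast
    then show ?thesis
      unfolding P5_def by (intro axes[OF power_probed[OF n] _ power_axes_disjoint[OF n]])
  qed
  have 25: P5 if P2
  proof -
    obtain n G where n: "n \<ge> 3" and G: "perm_subgroup n G"
      and "normal_ballean (symp_pts X n G) (symp_ent X Ent n G)"
      using \<open>P2\<close> unfolding P2_def by blast
    then show ?thesis
      unfolding P5_def
      \<comment> \<open>The shifted tuple has its first argument at positions \<open>0\<close> and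
        \<open>1\<close> and its second at position \<open>2\<close>.\<close>
      using axes[OF symp_probed[OF G, of 0 "\<lambda>i. i - 1" 2] _ symp_axes_disjoint[OF G n]] by simp
  qed
  have 65: P5 if "\<not> ultranormal X Ent" P6
  proof -
    obtain n G where n: "n \<ge> 2" and G: "perm_subgroup n G"
      and "normal_ballean (symp_pts X n G) (symp_ent X Ent n G)"
      using \<open>P6\<close> unfolding P6_def by blast
    then show ?thesis
      unfolding P5_def
      \<comment> \<open>For \<open>n = 2\<close> there is no room to repeat an entry, and a swap in
        \<open>G\<close> identifies \<open>k x p\<close> with \<open>k p x\<close>; disjointness
        must come from sets in \<open>X\<close>.\<close>
      using nonultra[OF symp_probed[OF G, of 0 id 1]] that(1) by simp
  qed
  have 95: P5 if "\<not> ultranormal X Ent" P9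
  proof -
    obtain n where n: "n \<ge> 2" and "normal_ballean (hyper_le_pts X Ent n) (hyper_le_ent X Ent n)"
      using \<open>P9\<close> unfolding P9_def by blast
    then show ?thesis
      unfolding P5_def using that(1) by (intro nonultra[OF hyper_le_probed[OF n]])
  qed
  have 115: P5 if "\<not> ultranormal X Ent" P11
    using that unfolding P5_def P11_def by (intro nonultra[OF hyper_probed])
  show ?thesis
    using 51 53 510 511 12 17 34 76 108 89 45 25 65 95 115 by sat
qed

end
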